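(* Let $X,Y\ge 2$ be constant integers and let $\bm{G}$ be any channel $g\colon\mathcal{X}\times\mathcal{X}\to\mathcal{Y}$ with $\mathcal{X}=\{0,\dots,X-1\}$, $\mathcal{Y}=\{0,\dots,Y-1\}$. For $U\in\{2,3,\dots\}$ let $W(U)$ be integers with $2\le W(U)\le U^2$ and $\lim_{U\to\infty}W(U)=\infty$, and let $\delta=\delta(U)$ satisfy $0<\delta\le 1/(2\ln W(U))$. Let $\mathcal{A}(U,W)$ denote the set of all functions $a\colon\{0,\dots,U-1\}^2\to\{0,\dots,W-1\}$. Then for any sequence of positive integers $n(U)$ satisfying $$\lim_{U\to\infty}\frac{\bigl|\{\bm{A}\in\mathcal{A}(U,W(U)) : (\bm{A},\bm{G}^{\otimes n(U)})\text{ is }\delta\text{-feasible}\}\bigr|}{|\mathcal{A}(U,W(U))|}>0,$$ there exists a joint distribution of random variables $(\mathsf{q},\mathsf{x}_1,\mathsf{x}_2,\mathsf{y})$ of the form $p(q)\,p(x_1|q)\,p(x_2|q)\,p(y|x_1,x_2)$, with $\mathsf{x}_1,\mathsf{x}_2$ taking values in $\mathcal{X}$ and $p(y|x_1,x_2)$ specified by the channel (i.e. $\mathsf{y}=g(\mathsf{x}_1,\mathsf{x}_2)$), such that $$U^2\mathrel{\dot\le}2^{n(U)H(\mathsf{y}|\mathsf{q})},\qquad U\mathrel{\dot\le}2^{n(U)H(\mathsf{y}|\mathsf{x}_1,\mathsf{q})},\qquad U\mathrel{\dot\le}2^{n(U)H(\mathsf{y}|\mathsf{x}_2,\mathsf{q})}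 .$$
   Context: $\log$ is the logarithm to base $2$, $\ln$ the natural logarithm, and $H(\cdot|\cdot)$ is conditional Shannon entropy in bits. For a positive function $F(U)$ and a constant $a$, $U^a\mathrel{\dot\le}F(U)$ means $\liminf_{U\to\infty}\frac{\log F(U)}{\log U}\ge a$. A target function $a\colon\mathcal{U}\times\mathcal{U}\to\mathcal{W}$, with $\mathcal{U}=\{0,\dots,U-1\}$ and $\mathcal{W}=\{0,\dots,W-1\}$, is identified with its matrix $\bm{A}$, and a channel $g$ with its matrix $\bm{G}$. $\bm{G}^{\otimes n}$ denotes the $n$-fold use of the channel: the channel with input alphabets $\mathcal{X}^n$ and output alphabet $\mathcal{Y}^n$ that maps $\bigl((x_1[i])_{i=1}^n,(x_2[i])_{i=1}^n\bigr)$ to $\bigl(g(x_1[i],x_2[i])\bigr)_{i=1}^n$. The pair $(\bm{A},\bm{G}^{\otimes n})$ is $\delta$-feasible if there exist encoders $f_1,f_2\colon\mathcal{U}\to\mathcal{X}^n$ and a decoder $\phi\colon\mathcal{Y}^n\to\mathcal{W}$ such that, for independent $\mathsf{u}_1,\mathsf{u}_2$ uniform on $\mathcal{U}$, the probability that $\phi$ applied to the output of $\bm{G}^{\otimes n}$ on inputs $f_1(\mathsf{u}_1),f_2(\mathsf{u}_2)$ differs from $a(\mathsf{u}_1,\mathsf{u}_2)$ is at most $\delta$. *)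

theory Defs
  imports "HOL-Probability.Probability"
begin

text \<open>All alphabets are initial segments \<^term>\<open>{..<k::nat}\<close>; words of length \<open>n\<close> over an alphabet \<open>A\<close>
  are the extensional functions \<^term>\<open>{..<n::nat} \<rightarrow>\<^sub>E A\<close>. A (deterministic two-user) channel is a
  function on pairs of inputs.\<close>

definition target_functions :: "nat \<Rightarrow> nat \<Rightarrow> (nat \<times> nat \<Rightarrow> nat) set" where
  "target_functions U W = ({..<U} \<times> {..<U}) \<rightarrow>\<^sub>E {..<W}"

definition words :: "nat \<Rightarrow> 'a set \<Rightarrow> (nat \<Rightarrow> 'a) set" where
  "words n A = {..<n} \<rightarrow>\<^sub>E A"

definition channel_power ::
  "nat \<Rightarrow> ('x \<times> 'x \<Rightarrow> 'y) \<Rightarrow> (nat \<Rightarrow> 'x) \<times> (nat \<Rightarrow> 'x) \<Rightarrow> (nat \<Rightarrow> 'y)" where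
  "channel_power n g = (\<lambda>(x1, x2). \<lambda>i\<in>{..<n}. g (x1 i, x2 i))"

text \<open>\<open>h\<close> is an arbitrary channel with input alphabets \<open>XX\<close>, \<open>XX\<close> and output alphabet \<open>YY\<close>.\<close>

definition feasible ::
  "nat \<Rightarrow> nat \<Rightarrow> 'x set \<Rightarrow> 'y set \<Rightarrow> real \<Rightarrow> (nat \<times> nat \<Rightarrow> nat) \<Rightarrow> ('x \<times> 'x \<Rightarrow> 'y) \<Rightarrow> bool" where
  "feasible U W XX YY \<delta> a h \<longleftrightarrow>
     (\<exists>f1 \<in> {..<U} \<rightarrow> XX. \<exists>f2 \<in> {..<U} \<rightarrow> XX. \<exists>\<phi> \<in> YY \<rightarrow> {..<W}.
        measure_pmf.prob (pair_pmf (pmf_of_set {..<U}) (pmf_of_set {..<U}))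
          {(u1, u2). \<phi> (h (f1 u1, f2 u2)) \<noteq> a (u1, u2)} \<le> \<delta>)"

text \<open>\<open>dot_le a F\<close> is the exponential inequality between \<open>U\<^sup>a\<close> and \<open>F(U)\<close>. The limit inferior is
  taken in the extended reals, since it may be infinite.\<close>

definition dot_le :: "real \<Rightarrow> (nat \<Rightarrow> real) \<Rightarrow> bool" where
  "dot_le a F \<longleftrightarrow> liminf (\<lambda>U. ereal (log 2 (F U) / log 2 (real U))) \<ge> ereal a"

definition cond_entropy :: "'a pmf \<Rightarrow> ('a \<Rightarrow> 'b) \<Rightarrow> ('a \<Rightarrow> 'c) \<Rightarrow> real" where
  "cond_entropy p S T =
     prob_space.conditional_entropy (measure_pmf p) 2 (count_space UNIV) (count_space UNIV) S T"

text \<open>The joint distribution \<open>p(q) p(x1|q) p(x2|q) p(y|x1,x2)\<close> of \<open>(q, x1, x2, y)\<close>, where \<open>p(y|x1,x2)\<close>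
  is the deterministic channel \<open>g\<close>.\<close>

definition joint_pmf ::
  "'q pmf \<Rightarrow> ('q \<Rightarrow> 'x pmf) \<Rightarrow> ('q \<Rightarrow> 'x pmf) \<Rightarrow> ('x \<times> 'x \<Rightarrow> 'y) \<Rightarrow> ('q \<times> 'x \<times> 'x \<times> 'y) pmf" where
  "joint_pmf pq p1 p2 g =
     bind_pmf pq (\<lambda>q. bind_pmf (p1 q) (\<lambda>x1. bind_pmf (p2 q) (\<lambda>x2.
       return_pmf (q, x1, x2, g (x1, x2)))))"

text \<open>For finitely supported distributions \<^const>\<open>cond_entropy\<close> is given by the usual sum.\<close>

lemma cond_entropy_eq_sum:
  fixes S :: "'a \<Rightarrow> 'b :: countable" and T :: "'a \<Rightarrow> 'c :: countable"
  assumes fin: "finite (set_pmf p)"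
  shows "cond_entropy p S T =
    - (\<Sum>(s, t) \<in> (\<lambda>\<omega>. (S \<omega>, T \<omega>)) ` set_pmf p.
         pmf (map_pmf (\<lambda>\<omega>. (S \<omega>, T \<omega>)) p) (s, t) *
         log 2 (pmf (map_pmf (\<lambda>\<omega>. (S \<omega>, T \<omega>)) p) (s, t) / pmf (map_pmf T p) t))"
proof -
  interpret information_space "measure_pmf p" 2
    by unfold_locales simp
  let ?J = "map_pmf (\<lambda>\<omega>. (S \<omega>, T \<omega>)) p"
  have prod: "count_space (UNIV :: 'b set) \<Otimes>\<^sub>M count_space (UNIV :: 'c set) = count_space UNIV"
    by (simp add: pair_measure_countable)
  have dist: "distributed (measure_pmf p) (count_space UNIV) Z (\<lambda>z. ennreal (pmf (map_pmf Z p) z))"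
    for Z :: "'a \<Rightarrow> 'd"
    unfolding distributed_def
    by (auto simp: map_pmf_rep_eq[symmetric] measure_pmf_eq_density[symmetric])
  have "cond_entropy p S T =
    - (\<integral>(s, t). pmf ?J (s, t) * log 2 (pmf ?J (s, t) / pmf (map_pmf T p) t)
        \<partial>(count_space UNIV \<Otimes>\<^sub>M count_space UNIV))"
    unfolding cond_entropy_def
    by (rule conditional_entropy_generic_eq)
       (auto simp: prod intro!: dist sigma_finite_measure_count_space)
  also have "\<dots> = - (\<integral>z. pmf ?J z * log 2 (pmf ?J z / pmf (map_pmf T p) (snd z))
        \<partial>count_space UNIV)"
    by (simp add: prod split_beta')
  also have "(\<integral>z. pmf ?J z * log 2 (pmf ?J z / pmf (map_pmf T p) (snd z)) \<partial>count_space UNIV) =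
    (\<integral>z. log 2 (pmf ?J z / pmf (map_pmf T p) (snd z)) \<partial>measure_pmf ?J)"
    by (simp add: measure_pmf_eq_density[of ?J] integral_density)
  also have "\<dots> = (\<Sum>z\<in>set_pmf ?J. log 2 (pmf ?J z / pmf (map_pmf T p) (snd z)) * pmf ?J z)"
    by (rule integral_measure_pmf_real) (use fin in auto)
  finally show ?thesis
    by (simp add: split_beta' mult.commute)
qed

end

theory Submission
  imports Defs
begin

text \<open>Counting: a code with \<open>N\<close> distinct channel outputs computes at most \<open>W\<^sup>N\<close> functions, there are
  only \<open>X\<close> to the power \<open>2 n U\<close> codes, and a Hamming ball of radius \<open>\<delta> U\<^sup>2\<close> has at most
  \<open>2\<close> to the \<open>U\<^sup>2\<close> times \<open>W\<close> to the \<open>\<delta> U\<^sup>2\<close> elements, which is \<open>W\<close> to the \<open>o(U\<^sup>2)\<close> because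
  \<open>\<delta> ln W \<le> 1/2\<close> and \<open>W \<rightarrow> \<infinity>\<close>. So if a positive fraction of all functions is feasible and \<open>n = O(U)\<close>
  with a small constant, some code has at least \<open>(1 - \<epsilon>) U\<^sup>2\<close> distinct outputs. The same count shows
  that \<open>g\<close> depends on both inputs.

  Entropy: choose one message pair per distinct output of such a code. Gibbs' inequality for the
  product of the single-letter output distributions bounds the sums over time of \<open>H(y)\<close>,
  \<open>H(y|x1)\<close>, \<open>H(y|x2)\<close> from below by about \<open>2 log U\<close>, \<open>log U\<close>, \<open>log U\<close>.

  One distribution for all \<open>U\<close>: averaging over time stays in the convex hull of the achievable
  triples \<open>t\<close>, which is compact, so \<open>min (t\<^sub>1 / 2) (min t\<^sub>2 t\<^sub>3)\<close> attains its maximum \<open>l\<close> there. The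
  maximiser satisfies \<open>n l \<ge> (1 - \<epsilon>) log U\<close> up to lower order terms whenever a good code exists; for the
  remaining, larger \<open>n\<close> it suffices that \<open>l > 0\<close>, witnessed by uniform inputs.\<close>

subsection \<open>Counting approximately computable functions\<close>

text \<open>Each such \<open>a\<close> is recovered from four data: the label map \<open>l\<close>,
  the decoder restricted to the labels that occur, the set \<open>S\<close> of wrong positions, and
  the values of \<open>a\<close> on \<open>S\<close>. The four factors of the bound count the
  choices for these data.\<close>

lemma card_approximable_le:
  fixes L :: "('d \<Rightarrow> 'l) set"
  assumes D: "finite D" and L: "finite L" and M: "\<And>l. l \<in> L \<Longrightarrow> card (l ` D) \<le> M" and W: "W \<ge> 1"
  shows "card {a \<in> D \<rightarrow>\<^sub>E {..<W}. \<exists>l\<in>L. \<exists>\<phi>. (\<forall>d\<in>D. \<phi> (l d) < W) \<and>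
           card {d\<in>D. \<phi> (l d) \<noteq> a d} \<le> k} \<le> card L * (W ^ M * (2 ^ card D * W ^ k))"
    (is "card ?A \<le> _")
proof -
  define B where "B = (SIGMA l:L. SIGMA \<psi>:(l ` D \<rightarrow>\<^sub>E {..<W}). SIGMA S:{S. S \<subseteq> D \<and> card S \<le> k}. S \<rightarrow>\<^sub>E {..<W})"
  define f where "f = (\<lambda>(l :: 'd \<Rightarrow> 'l, \<psi>, S, r). \<lambda>d\<in>D. if d \<in> S then r d else \<psi> (l d) :: nat)"
  have finS: "finite S" if "S \<subseteq> D" for S using that D finite_subset by blast
  have finsub: "finite {S. S \<subseteq> D \<and> card S \<le> k}" using D by (auto intro: finite_subset[of _ "Pow D"])
  have cardr: "card (S \<rightarrow>\<^sub>E {..<W}) \<le> W ^ k" if "S \<subseteq> D" "card S \<le> k" for S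
    using W that finS by (simp add: card_PiE power_increasing)
  have c1: "card (SIGMA S:{S. S \<subseteq> D \<and> card S \<le> k}. S \<rightarrow>\<^sub>E {..<W}) \<le> 2 ^ card D * W ^ k"
  proof -
    have "card (SIGMA S:{S. S \<subseteq> D \<and> card S \<le> k}. S \<rightarrow>\<^sub>E {..<W})
        = (\<Sum>S\<in>{S. S \<subseteq> D \<and> card S \<le> k}. card (S \<rightarrow>\<^sub>E {..<W}))"
      by (rule card_SigmaI) (use finsub finS in \<open>auto intro!: finite_PiE\<close>)
    also have "\<dots> \<le> (\<Sum>S\<in>{S. S \<subseteq> D \<and> card S \<le> k}. W ^ k)"
      by (rule sum_mono) (use cardr in auto)
    also have "\<dots> = card {S. S \<subseteq> D \<and> card S \<le> k} * W ^ k" by simp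
    also have "card {S. S \<subseteq> D \<and> card S \<le> k} \<le> card (Pow D)"
      by (rule card_mono) (use D in auto)
    finally show ?thesis using D by (simp add: card_Pow)
  qed
  have fin1: "finite (SIGMA S:{S. S \<subseteq> D \<and> card S \<le> k}. S \<rightarrow>\<^sub>E {..<W})"
    using finsub finS by (intro finite_SigmaI finite_PiE) auto
  have fin2: "finite (SIGMA \<psi>:(l ` D \<rightarrow>\<^sub>E {..<W}). SIGMA S:{S. S \<subseteq> D \<and> card S \<le> k}. S \<rightarrow>\<^sub>E {..<W})" for l
    by (rule finite_SigmaI[OF finite_PiE fin1]) (use D in auto)
  have finB: "finite B" unfolding B_def by (rule finite_SigmaI[OF L fin2])
  have "card B = (\<Sum>l\<in>L. card (l ` D \<rightarrow>\<^sub>E {..<W}) * card (SIGMA S:{S. S \<subseteq> D \<and> card S \<le> k}. S \<rightarrow>\<^sub>E {..<W}))"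
    unfolding B_def by (subst card_SigmaI) (use L fin2 in \<open>auto simp: card_cartesian_product\<close>)
  also have "\<dots> \<le> (\<Sum>l\<in>L. W ^ M * (2 ^ card D * W ^ k))"
    by (intro sum_mono mult_mono c1) (use M W D in \<open>auto simp: card_PiE intro!: power_increasing\<close>)
  finally have cB: "card B \<le> card L * (W ^ M * (2 ^ card D * W ^ k))" by simp
  have "?A \<subseteq> f ` B"
  proof
    fix a assume "a \<in> ?A"
    then obtain l \<phi> where a: "a \<in> D \<rightarrow>\<^sub>E {..<W}" and l: "l \<in> L" and \<phi>: "\<forall>d\<in>D. \<phi> (l d) < W"
      and k: "card {d\<in>D. \<phi> (l d) \<noteq> a d} \<le> k" by blast
    let ?S = "{d\<in>D. \<phi> (l d) \<noteq> a d}"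
    have "a = f (l, restrict \<phi> (l ` D), ?S, restrict a ?S)"
      using a unfolding f_def by (auto simp: fun_eq_iff PiE_def extensional_def)
    moreover have "(l, restrict \<phi> (l ` D), ?S, restrict a ?S) \<in> B"
      unfolding B_def using a l \<phi> k by (auto simp: PiE_def Pi_def)
    ultimately show "a \<in> f ` B" by blast
  qed
  then have "card ?A \<le> card B" using finB by (rule surj_card_le[rotated])
  then show ?thesis using cB by linarith
qed

lemma finite_words: "finite (words n {..<X::nat})"
  unfolding words_def by (intro finite_PiE) auto

lemma card_words: "card (words n {..<X::nat}) = X ^ n"
  unfolding words_def by (simp add: card_PiE)

text \<open>Message pairs are uniform on the square, so the error probability is the number of wrong
  pairs over \<open>U^2\<close>. That number is an integer, which permits the floor.\<close>

lemma feasible_obtain: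
  assumes "feasible U W XX YY \<delta> a h" "U > 0"
  obtains f1 f2 \<phi> where "f1 \<in> {..<U} \<rightarrow> XX" "f2 \<in> {..<U} \<rightarrow> XX" "\<phi> \<in> YY \<rightarrow> {..<W}"
    "card {d \<in> {..<U} \<times> {..<U}. \<phi> (h (f1 (fst d), f2 (snd d))) \<noteq> a d} \<le> nat \<lfloor>\<delta> * real U ^ 2\<rfloor>"
proof -
  obtain f1 f2 \<phi> where f: "f1 \<in> {..<U} \<rightarrow> XX" "f2 \<in> {..<U} \<rightarrow> XX" "\<phi> \<in> YY \<rightarrow> {..<W}"
    and p: "measure_pmf.prob (pair_pmf (pmf_of_set {..<U}) (pmf_of_set {..<U}))
          {(u1, u2). \<phi> (h (f1 u1, f2 u2)) \<noteq> a (u1, u2)} \<le> \<delta>"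
    using assms unfolding feasible_def by blast
  let ?D = "{..<U} \<times> {..<U}"
  have ne: "{..<U} \<noteq> {}" using assms by auto
  have eq: "pair_pmf (pmf_of_set {..<U}) (pmf_of_set {..<U}) = pmf_of_set ?D"
    by (rule pmf_eqI) (use ne in \<open>auto simp: pmf_pair pmf_of_set[OF ne] pmf_of_set[of ?D] indicator_def\<close>)
  have "measure_pmf.prob (pmf_of_set ?D) {(u1, u2). \<phi> (h (f1 u1, f2 u2)) \<noteq> a (u1, u2)}
     = card (?D \<inter> {(u1, u2). \<phi> (h (f1 u1, f2 u2)) \<noteq> a (u1, u2)}) / card ?D"
    by (rule measure_pmf_of_set) (use ne in auto)
  also have "?D \<inter> {(u1, u2). \<phi> (h (f1 u1, f2 u2)) \<noteq> a (u1, u2)}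
      = {d \<in> ?D. \<phi> (h (f1 (fst d), f2 (snd d))) \<noteq> a d}" by auto
  finally have "real (card {d \<in> ?D. \<phi> (h (f1 (fst d), f2 (snd d))) \<noteq> a d}) \<le> \<delta> * real U ^ 2"
    using mult_left_mono[OF p, of "real U ^ 2"] assms(2) unfolding eq
    by (simp add: field_simps power2_eq_square)
  then have "card {d \<in> ?D. \<phi> (h (f1 (fst d), f2 (snd d))) \<noteq> a d} \<le> nat \<lfloor>\<delta> * real U ^ 2\<rfloor>"
    by (simp add: le_nat_floor)
  with f that show ?thesis by blast
qed

text \<open>A label stands for whatever the decoder's decision factors through: the channel output
  of a code, or one message alone if the channel ignores the other.
  \<open>card_approximable_le\<close> gives at most \<open>exp (U^2) * W powr ((1 - \<epsilon>) U^2)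
  * 2^(U^2) * exp (U^2 / 2)\<close> feasible functions, to be divided by
  \<open>W^(U^2)\<close>.\<close>

lemma feasible_fraction_le:
  fixes L :: "(nat \<times> nat \<Rightarrow> 'l) set" and h :: "'x \<times> 'x \<Rightarrow> 'y" and \<delta> \<epsilon> :: real
  defines "D U \<equiv> {..<U} \<times> {..<U::nat}"
  assumes U: "U \<ge> 2" and W: "W \<ge> 2" and \<delta>: "\<delta> \<le> 1 / (2 * ln (real W))"
    and L: "finite L" "real (card L) \<le> exp (real U ^ 2)"
    and M: "\<And>l. l \<in> L \<Longrightarrow> real (card (l ` D U)) \<le> (1 - \<epsilon>) * real U ^ 2"
    and LL: "\<And>f1 f2 \<phi>. f1 \<in> {..<U} \<rightarrow> XX \<Longrightarrow> f2 \<in> {..<U} \<rightarrow> XX \<Longrightarrow> \<phi> \<in> YY \<rightarrow> {..<W} \<Longrightarrow>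
        \<exists>l\<in>L. \<exists>\<psi>. \<forall>d\<in>D U. \<psi> (l d) = \<phi> (h (f1 (fst d), f2 (snd d))) \<and> \<psi> (l d) < W"
  shows "real (card {a \<in> target_functions U W. feasible U W XX YY \<delta> a h}) / real (card (target_functions U W))
     \<le> (2 * exp (3/2) / real W powr \<epsilon>) ^ (U ^ 2)"
proof (cases "L = {}")
  \<comment> \<open>Without labels no function is feasible. With a label, \<open>M\<close> forces
    \<open>(1 - \<epsilon>) U^2\<close> to be nonnegative, so that its floor can be bounded by
    it.\<close>
  case True
  then have "{a \<in> target_functions U W. feasible U W XX YY \<delta> a h} = {}"
    using LL U by (auto elim!: feasible_obtain)
  then show ?thesis by (simp only: card.empty) simp
next
  case False
  let ?k = "nat \<lfloor>\<delta> * real U ^ 2\<rfloor>"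
  let ?m = "(1 - \<epsilon>) * real U ^ 2"
  let ?M = "nat \<lfloor>?m\<rfloor>"
  let ?N = "U ^ 2"
  have finD: "finite (D U)" and cardD: "card (D U) = U ^ 2"
    unfolding D_def by (auto simp: card_cartesian_product power2_eq_square)
  have W0: "real W > 0" "real W \<ge> 1" "ln (real W) > 0" using W by auto
  have tf: "card (target_functions U W) = W ^ (U ^ 2)" "finite (target_functions U W)"
    unfolding target_functions_def D_def[symmetric] using finD cardD by (auto simp: card_PiE intro!: finite_PiE)
  have "{a \<in> target_functions U W. feasible U W XX YY \<delta> a h} \<subseteq>
    {a \<in> D U \<rightarrow>\<^sub>E {..<W}. \<exists>l\<in>L. \<exists>\<phi>. (\<forall>d\<in>D U. \<phi> (l d) < W) \<and>
           card {d\<in>D U. \<phi> (l d) \<noteq> a d} \<le> ?k}"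
  proof (intro subsetI CollectI conjI)
    fix a assume "a \<in> {a \<in> target_functions U W. feasible U W XX YY \<delta> a h}"
    then have a: "a \<in> target_functions U W" and fe: "feasible U W XX YY \<delta> a h" by auto
    show "a \<in> D U \<rightarrow>\<^sub>E {..<W}" unfolding D_def using a by (simp add: target_functions_def)
    obtain f1 f2 \<phi> where f: "f1 \<in> {..<U} \<rightarrow> XX" "f2 \<in> {..<U} \<rightarrow> XX" "\<phi> \<in> YY \<rightarrow> {..<W}"
      and c: "card {d \<in> D U. \<phi> (h (f1 (fst d), f2 (snd d))) \<noteq> a d} \<le> ?k"
      using feasible_obtain[OF fe] U unfolding D_def by auto
    obtain l \<psi> where l: "l \<in> L" and \<psi>: "\<forall>d\<in>D U. \<psi> (l d) = \<phi> (h (f1 (fst d), f2 (snd d))) \<and> \<psi> (l d) < W"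
      using LL[OF f] by blast
    have "{d\<in>D U. \<psi> (l d) \<noteq> a d} = {d \<in> D U. \<phi> (h (f1 (fst d), f2 (snd d))) \<noteq> a d}"
      using \<psi> by auto
    then have "card {d\<in>D U. \<psi> (l d) \<noteq> a d} \<le> ?k" using c by simp
    with l \<psi> show "\<exists>l\<in>L. \<exists>\<phi>. (\<forall>d\<in>D U. \<phi> (l d) < W) \<and> card {d\<in>D U. \<phi> (l d) \<noteq> a d} \<le> ?k"
      by blast
  qed
  then have "card {a \<in> target_functions U W. feasible U W XX YY \<delta> a h} \<le>
      card {a \<in> D U \<rightarrow>\<^sub>E {..<W}. \<exists>l\<in>L. \<exists>\<phi>. (\<forall>d\<in>D U. \<phi> (l d) < W) \<and>
           card {d\<in>D U. \<phi> (l d) \<noteq> a d} \<le> ?k}"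
    by (rule card_mono[rotated]) (rule finite_subset[of _ "D U \<rightarrow>\<^sub>E {..<W}"],
        use finD in \<open>auto intro!: finite_PiE\<close>)
  also have "\<dots> \<le> card L * (W ^ ?M * (2 ^ card (D U) * W ^ ?k))"
    by (rule card_approximable_le) (use finD L M W in \<open>auto intro!: le_nat_floor\<close>)
  finally have "real (card {a \<in> target_functions U W. feasible U W XX YY \<delta> a h})
     \<le> real (card L * (W ^ ?M * (2 ^ card (D U) * W ^ ?k)))" by (simp only: of_nat_le_iff)
  also have "\<dots> = real (card L) * (real W ^ ?M * (2 ^ ?N * real W ^ ?k))"
    by (simp add: cardD)
  also have "\<dots> \<le> exp (real U ^ 2) * (real W powr ?m * (2 ^ ?N * exp (real U ^ 2 / 2)))"
  proof (intro mult_mono L)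
    obtain l where "l \<in> L" using False by blast
    then have "0 \<le> ?m" using M[of l] by (meson of_nat_0_le_iff order_trans)
    then have "real ?M \<le> ?m" by (rule of_nat_floor)
    then have "real W powr real ?M \<le> real W powr ?m" using W0 by (intro powr_mono) auto
    then show "real W ^ ?M \<le> real W powr ?m" using W0 by (simp add: powr_realpow)
    \<comment> \<open>Correcting a \<open>\<delta>\<close> fraction of the values costs only a
      factor exponential in \<open>U^2\<close>, independent of \<open>W\<close>: this is where
      \<open>\<delta> ln W \<le> 1/2\<close> enters.\<close>
    show "real W ^ ?k \<le> exp (real U ^ 2 / 2)"
    proof -
      have "real W ^ ?k = exp (real ?k * ln (real W))" using W0 by (simp add: exp_of_nat_mult)
      also have "real ?k \<le> real U ^ 2 / (2 * ln (real W))"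
      proof -
        have "\<delta> * real U ^ 2 \<le> 1 / (2 * ln (real W)) * real U ^ 2"
          by (rule mult_right_mono[OF \<delta>]) simp
        also have "\<dots> = real U ^ 2 / (2 * ln (real W))" by simp
        finally have "?k \<le> nat \<lfloor>real U ^ 2 / (2 * ln (real W))\<rfloor>" by (intro nat_mono floor_mono)
        moreover have "real (nat \<lfloor>real U ^ 2 / (2 * ln (real W))\<rfloor>) \<le> real U ^ 2 / (2 * ln (real W))"
          using W0 by (intro of_nat_floor) auto
        ultimately show ?thesis by linarith
      qed
      then have "exp (real ?k * ln (real W)) \<le> exp (real U ^ 2 / (2 * ln (real W)) * ln (real W))"
        using W0 by (intro iffD2[OF exp_le_cancel_iff] mult_right_mono) auto
      also have "\<dots> = exp (real U ^ 2 / 2)" using W0 by simp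
      finally show ?thesis .
    qed
  qed auto
  also have "\<dots> = (2 * exp (3/2) / real W powr \<epsilon>) ^ ?N * real W ^ ?N"
  proof -
    have e: "exp (3/2 * real U ^ 2) = exp (3/2 :: real) ^ ?N"
      by (metis exp_of_nat_mult mult.commute of_nat_power)
    have w: "real W powr ?m = real W ^ ?N / (real W powr \<epsilon>) ^ ?N"
    proof -
      have "real W powr ?m = real W powr (real U ^ 2) / real W powr (\<epsilon> * real U ^ 2)"
        by (simp add: algebra_simps powr_diff)
      moreover have "real W powr (real U ^ 2) = real W ^ ?N"
        using W0 powr_realpow[of "real W" ?N] by simp
      moreover have "real W powr (\<epsilon> * real U ^ 2) = (real W powr \<epsilon>) ^ ?N"
        using W0 powr_realpow[of "real W powr \<epsilon>" ?N] by (simp add: powr_powr)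
      ultimately show ?thesis by simp
    qed
    have "exp (real U ^ 2) * exp (real U ^ 2 / 2) = exp (3/2 :: real) ^ ?N"
      unfolding e[symmetric] mult_exp_exp by simp
    then show ?thesis unfolding w power_mult_distrib power_divide by (simp add: field_simps)
  qed
  finally show ?thesis using W0 by (simp add: tf field_simps)
qed

subsection \<open>Gibbs' inequality for codes\<close>

text \<open>Gibbs' inequality of the uniform distribution on \<open>R\<close> against the weights
  \<open>\<pi> / B\<close> of total mass at most one, derived from \<open>ln x \<le> x - 1\<close>
  at \<open>x = \<pi> d * card R / B\<close>.\<close>

lemma sum_neg_log_ge:
  fixes \<pi> :: "'a \<Rightarrow> real"
  assumes R: "finite R" and pos: "\<And>d. d \<in> R \<Longrightarrow> \<pi> d > 0" and B: "B > 0" "sum \<pi> R \<le> B"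
  shows "real (card R) * log 2 (real (card R) / B) \<le> (\<Sum>d\<in>R. - log 2 (\<pi> d))"
proof (cases "R = {}")
  case False
  define c where "c = real (card R)"
  have c: "c > 0" using R False by (simp add: c_def card_gt_0_iff)
  have "(\<Sum>d\<in>R. ln (\<pi> d) + ln (c / B)) \<le> (\<Sum>d\<in>R. \<pi> d * (c / B) - 1)"
  proof (rule sum_mono)
    fix d assume "d \<in> R"
    then show "ln (\<pi> d) + ln (c / B) \<le> \<pi> d * (c / B) - 1"
      using pos[of d] c B ln_le_minus_one[of "\<pi> d * (c / B)"] ln_mult_pos[of "\<pi> d" "c / B"] by simp
  qed
  also have "\<dots> = sum \<pi> R * (c / B) - c" by (simp add: sum_subtractf sum_distrib_right[symmetric] sum_divide_distrib[symmetric] c_def)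
  also have "\<dots> \<le> B * (c / B) - c" using B c by (intro diff_right_mono mult_right_mono) auto
  also have "\<dots> = 0" using B by simp
  finally have "c * ln (c / B) \<le> (\<Sum>d\<in>R. - ln (\<pi> d))"
    by (simp add: sum.distrib sum_negf c_def)
  then have "c * ln (c / B) / ln 2 \<le> (\<Sum>d\<in>R. - ln (\<pi> d)) / ln 2" by (simp add: divide_right_mono)
  then show ?thesis by (simp add: log_def sum_divide_distrib c_def)
qed simp

text \<open>\<open>R\<close> picks one representative per distinct codeword. The class \<open>\<kappa> d\<close> is the conditioning: it is
  constant for \<open>H(y)\<close> and the first (second) message for \<open>H(y|x1)\<close> (\<open>H(y|x2)\<close>); the Gibbs weights
  of the representatives sum to at most one per class.\<close>

lemma code_entropy_ge:
  fixes F :: "'d \<Rightarrow> nat \<Rightarrow> nat" and r :: "'c \<Rightarrow> nat \<Rightarrow> nat \<Rightarrow> real"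
  assumes D: "finite D" "D \<noteq> {}" and R: "R \<subseteq> D" "inj_on F R"
    and F: "\<And>d. d \<in> D \<Longrightarrow> F d \<in> words n {..<Y}"
    and pos: "\<And>d i. d \<in> D \<Longrightarrow> i < n \<Longrightarrow> r (\<kappa> d) i (F d i) > 0"
    and nonneg: "\<And>c i y. r c i y \<ge> 0"
    and one: "\<And>d i. d \<in> D \<Longrightarrow> i < n \<Longrightarrow> (\<Sum>y<Y. r (\<kappa> d) i y) = 1"
  shows "real (card R) * log 2 (real (card R) / real (card (\<kappa> ` D)))
           \<le> (\<Sum>i<n. \<Sum>d\<in>D. - log 2 (r (\<kappa> d) i (F d i)))"
proof -
  \<comment> \<open>The Gibbs weight: the likelihood of the codeword if its letters were independent
    over time with laws \<open>r (\<kappa> d) i\<close>.\<close>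
  define \<pi> where "\<pi> d = (\<Prod>i<n. r (\<kappa> d) i (F d i))" for d
  have finR: "finite R" using D R finite_subset by blast
  have le1: "r (\<kappa> d) i (F d i) \<le> 1" if "d \<in> D" "i < n" for d i
  proof -
    have "F d i < Y" using F[OF that(1)] that(2) by (auto simp: words_def)
    then have "r (\<kappa> d) i (F d i) \<le> (\<Sum>y<Y. r (\<kappa> d) i y)"
      by (intro member_le_sum) (auto simp: nonneg)
    then show ?thesis using one that by simp
  qed
  have "sum \<pi> R = (\<Sum>c\<in>\<kappa> ` D. \<Sum>d\<in>{d\<in>R. \<kappa> d = c}. \<pi> d)"
    by (rule sum.group[symmetric]) (use D R finR in auto)
  also have "\<dots> \<le> (\<Sum>c\<in>\<kappa> ` D. 1)"
  proof (rule sum_mono)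
    fix c assume c: "c \<in> \<kappa> ` D"
    \<comment> \<open>Injectivity on \<open>R\<close> turns representatives into distinct words; the
      sum over all words then factorises into total masses.\<close>
    have "(\<Sum>d\<in>{d\<in>R. \<kappa> d = c}. \<pi> d) = (\<Sum>w\<in>F ` {d\<in>R. \<kappa> d = c}. \<Prod>i<n. r c i (w i))"
      by (subst sum.reindex) (use R in \<open>auto simp: \<pi>_def intro: inj_on_subset\<close>)
    also have "\<dots> \<le> (\<Sum>w\<in>{..<n} \<rightarrow>\<^sub>E {..<Y}. \<Prod>i<n. r c i (w i))"
      by (rule sum_mono2) (use F R in \<open>auto simp: words_def nonneg intro!: prod_nonneg finite_PiE\<close>)
    also have "\<dots> = (\<Prod>i<n. \<Sum>y<Y. r c i y)"
      by (rule prod_sum_PiE[symmetric]) auto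
    also have "\<dots> = 1" using one c by auto
    finally show "(\<Sum>d\<in>{d\<in>R. \<kappa> d = c}. \<pi> d) \<le> 1" .
  qed
  also have "\<dots> = real (card (\<kappa> ` D))" by simp
  finally have "real (card R) * log 2 (real (card R) / real (card (\<kappa> ` D))) \<le> (\<Sum>d\<in>R. - log 2 (\<pi> d))"
    using D R pos by (intro sum_neg_log_ge finR) (auto simp: \<pi>_def card_gt_0_iff intro!: prod_pos)
  also have "\<dots> = (\<Sum>d\<in>R. \<Sum>i<n. - log 2 (r (\<kappa> d) i (F d i)))"
  proof (rule sum.cong[OF refl])
    fix d assume "d \<in> R"
    then have p: "r (\<kappa> d) i (F d i) > 0" if "i < n" for i using pos R that by auto
    then show "- log 2 (\<pi> d) = (\<Sum>i<n. - log 2 (r (\<kappa> d) i (F d i)))"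
      unfolding \<pi>_def log_def
      by (subst ln_prod) (auto simp: sum_negf sum_divide_distrib dest!: p)
  qed
  \<comment> \<open>Passing from representatives to all message pairs only adds nonnegative terms,
    as likelihoods are at most one.\<close>
  also have "\<dots> \<le> (\<Sum>d\<in>D. \<Sum>i<n. - log 2 (r (\<kappa> d) i (F d i)))"
    by (rule sum_mono2) (use D R pos le1 in \<open>auto intro!: sum_nonpos simp: sum_negf\<close>)
  also have "\<dots> = (\<Sum>i<n. \<Sum>d\<in>D. - log 2 (r (\<kappa> d) i (F d i)))"
    by (rule sum.swap)
  finally show ?thesis .
qed

subsection \<open>Single-letter entropies\<close>

text \<open>Extension by zero makes these vectors points of the product space of all functions on
  the naturals, where compactness is available, and makes them mass functions of a
  \<open>nat pmf\<close>.\<close>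

definition prob_vectors :: "nat \<Rightarrow> (nat \<Rightarrow> real) set" where
  "prob_vectors X = {a. (\<forall>x. 0 \<le> a x) \<and> (\<forall>x\<ge>X. a x = 0) \<and> (\<Sum>x<X. a x) = 1}"

text \<open>The law of \<open>y\<close> given \<open>x1\<close> when \<open>x2\<close> has law
  \<open>b\<close>; \<open>x1\<close> selects a row of the channel matrix.\<close>

definition row_prob :: "nat \<Rightarrow> (nat \<times> nat \<Rightarrow> nat) \<Rightarrow> (nat \<Rightarrow> real) \<Rightarrow> nat \<Rightarrow> nat \<Rightarrow> real" where
  "row_prob X g b x1 y = (\<Sum>x2<X. b x2 * of_bool (g (x1, x2) = y))"

definition out_prob :: "nat \<Rightarrow> (nat \<times> nat \<Rightarrow> nat) \<Rightarrow> (nat \<Rightarrow> real) \<Rightarrow> (nat \<Rightarrow> real) \<Rightarrow> nat \<Rightarrow> real" where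
  "out_prob X g a b y = (\<Sum>x1<X. a x1 * row_prob X g b x1 y)"

text \<open>This is \<open>H(y)\<close> for independent inputs with laws \<open>a\<close> and
  \<open>b\<close>, written as an expectation over input pairs because a code produces averages over
  message pairs.\<close>

definition out_entropy :: "nat \<Rightarrow> (nat \<times> nat \<Rightarrow> nat) \<Rightarrow> (nat \<Rightarrow> real) \<Rightarrow> (nat \<Rightarrow> real) \<Rightarrow> real" where
  "out_entropy X g a b =
     (\<Sum>x1<X. a x1 * (\<Sum>x2<X. b x2 * - log 2 (out_prob X g a b (g (x1, x2)))))"

text \<open>This is \<open>H(y|x1)\<close>. Exchanging the two inputs of \<open>g\<close> and the
  two laws yields \<open>H(y|x2)\<close>.\<close>

definition row_entropy :: "nat \<Rightarrow> (nat \<times> nat \<Rightarrow> nat) \<Rightarrow> (nat \<Rightarrow> real) \<Rightarrow> (nat \<Rightarrow> real) \<Rightarrow> real" where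
  "row_entropy X g a b =
     (\<Sum>x1<X. a x1 * (\<Sum>x2<X. b x2 * - log 2 (row_prob X g b x1 (g (x1, x2)))))"

definition neg_xlog :: "real \<Rightarrow> real" where
  "neg_xlog t = t * - log 2 t"

lemma sum_of_bool_g:
  fixes g :: "nat \<times> nat \<Rightarrow> nat"
  assumes "g (x1, x2) < Y"
  shows "(\<Sum>y<Y. (of_bool (g (x1, x2) = y) :: real) * f y) = f (g (x1, x2))"
  using assms by (simp add: of_bool_def if_distrib[of "\<lambda>z. z * _"] cong: if_cong)

text \<open>Inputs are grouped by the output they cause. With \<open>f\<close> a log-likelihood this
  links the input form and the output form of the entropy; with \<open>f\<close> constantly one it
  gives the total mass.\<close>

lemma row_prob_sum:
  assumes g: "g \<in> {..<X} \<times> {..<X} \<rightarrow> {..<Y}" and x1: "x1 < X"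
  shows "(\<Sum>y<Y. row_prob X g b x1 y * f y) = (\<Sum>x2<X. b x2 * f (g (x1, x2)))"
proof -
  have "(\<Sum>y<Y. row_prob X g b x1 y * f y) = (\<Sum>x2<X. \<Sum>y<Y. b x2 * (of_bool (g (x1, x2) = y) * f y))"
    unfolding row_prob_def sum_distrib_right by (subst sum.swap) (simp add: mult.assoc)
  also have "\<dots> = (\<Sum>x2<X. b x2 * f (g (x1, x2)))"
    unfolding sum_distrib_left[symmetric]
    by (intro sum.cong refl arg_cong2[of _ _ _ _ "(*)"] sum_of_bool_g) (use g x1 in auto)
  finally show ?thesis .
qed

lemma out_prob_sum:
  assumes g: "g \<in> {..<X} \<times> {..<X} \<rightarrow> {..<Y}"
  shows "(\<Sum>y<Y. out_prob X g a b y * f y) = (\<Sum>x1<X. a x1 * (\<Sum>x2<X. b x2 * f (g (x1, x2))))"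
proof -
  have "(\<Sum>y<Y. out_prob X g a b y * f y) = (\<Sum>x1<X. a x1 * (\<Sum>y<Y. row_prob X g b x1 y * f y))"
    unfolding out_prob_def sum_distrib_right sum_distrib_left by (subst sum.swap) (simp add: mult.assoc)
  also have "\<dots> = (\<Sum>x1<X. a x1 * (\<Sum>x2<X. b x2 * f (g (x1, x2))))"
    by (intro sum.cong refl) (simp add: row_prob_sum[OF g])
  finally show ?thesis .
qed

lemma out_entropy_eq:
  assumes "g \<in> {..<X} \<times> {..<X} \<rightarrow> {..<Y}"
  shows "out_entropy X g a b = (\<Sum>y<Y. neg_xlog (out_prob X g a b y))"
  unfolding out_entropy_def neg_xlog_def by (rule out_prob_sum[OF assms, symmetric])

lemma row_entropy_eq:
  assumes "g \<in> {..<X} \<times> {..<X} \<rightarrow> {..<Y}"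
  shows "row_entropy X g a b = (\<Sum>x1<X. a x1 * (\<Sum>y<Y. neg_xlog (row_prob X g b x1 y)))"
  unfolding row_entropy_def neg_xlog_def
  by (intro sum.cong refl) (simp only: lessThan_iff row_prob_sum[OF assms])

lemma row_prob_total:
  assumes "g \<in> {..<X} \<times> {..<X} \<rightarrow> {..<Y}" "b \<in> prob_vectors X" "x1 < X"
  shows "(\<Sum>y<Y. row_prob X g b x1 y) = 1"
  using row_prob_sum[OF assms(1,3), of b "\<lambda>_. 1"] assms(2) by (simp add: prob_vectors_def)

lemma out_prob_total:
  assumes "g \<in> {..<X} \<times> {..<X} \<rightarrow> {..<Y}" "a \<in> prob_vectors X" "b \<in> prob_vectors X"
  shows "(\<Sum>y<Y. out_prob X g a b y) = 1"
  using out_prob_sum[OF assms(1), of a b "\<lambda>_. 1"] assms(2,3) by (simp add: prob_vectors_def)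

lemma row_prob_nonneg: "b \<in> prob_vectors X \<Longrightarrow> row_prob X g b x1 y \<ge> 0"
  unfolding row_prob_def prob_vectors_def by (auto intro!: sum_nonneg)

lemma out_prob_nonneg: "a \<in> prob_vectors X \<Longrightarrow> b \<in> prob_vectors X \<Longrightarrow> out_prob X g a b y \<ge> 0"
  unfolding out_prob_def by (intro sum_nonneg mult_nonneg_nonneg row_prob_nonneg) (auto simp: prob_vectors_def)

text \<open>A single term of the sum; it keeps the likelihoods of outputs that really occur
  positive, so that their logarithms are meaningful.\<close>

lemma row_prob_ge:
  assumes "b \<in> prob_vectors X" "x2 < X"
  shows "row_prob X g b x1 (g (x1, x2)) \<ge> b x2"
proof -
  have "b x2 * of_bool (g (x1, x2) = g (x1, x2)) \<le> row_prob X g b x1 (g (x1, x2))"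
    unfolding row_prob_def by (rule member_le_sum) (use assms in \<open>auto simp: prob_vectors_def\<close>)
  then show ?thesis by simp
qed

lemma out_prob_ge:
  assumes "a \<in> prob_vectors X" "b \<in> prob_vectors X" "x1 < X" "x2 < X"
  shows "out_prob X g a b (g (x1, x2)) \<ge> a x1 * b x2"
proof -
  have "a x1 * b x2 \<le> a x1 * row_prob X g b x1 (g (x1, x2))"
    using assms row_prob_ge by (intro mult_left_mono) (auto simp: prob_vectors_def)
  also have "\<dots> \<le> out_prob X g a b (g (x1, x2))"
    unfolding out_prob_def
    by (rule member_le_sum) (use assms row_prob_nonneg[OF assms(2)] in \<open>auto simp: prob_vectors_def\<close>)
  finally show ?thesis .
qed

section \<open>Empirical letter distributions of a code\<close>

definition empirical :: "nat \<Rightarrow> (nat \<Rightarrow> nat) \<Rightarrow> nat \<Rightarrow> real" where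
  "empirical U f x = (\<Sum>u<U. of_bool (f u = x)) / real U"

lemma sum_empirical:
  assumes "\<And>u. u < U \<Longrightarrow> f u < X"
  shows "(\<Sum>x<X. empirical U f x * \<phi> x) = (\<Sum>u<U. \<phi> (f u)) / real U"
proof -
  have "(\<Sum>x<X. empirical U f x * \<phi> x) = (\<Sum>u<U. \<Sum>x<X. of_bool (f u = x) * \<phi> x) / real U"
    unfolding empirical_def by (subst sum.swap) (simp add: sum_distrib_right sum_divide_distrib)
  also have "(\<Sum>u<U. \<Sum>x<X. of_bool (f u = x) * \<phi> x) = (\<Sum>u<U. \<phi> (f u))"
    using assms by (intro sum.cong refl)
      (simp add: of_bool_def if_distrib[of "\<lambda>z. z * _"] cong: if_cong)
  finally show ?thesis .
qed

lemma empirical_in_prob_vectors: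
  assumes "U > 0" "\<And>u. u < U \<Longrightarrow> f u < X"
  shows "empirical U f \<in> prob_vectors X"
proof -
  have "(\<Sum>x<X. empirical U f x) = 1"
    using sum_empirical[of U f X "\<lambda>_. 1"] assms by simp
  moreover have "empirical U f x = 0" if "x \<ge> X" for x
    unfolding empirical_def using assms that by (force intro!: sum.neutral)
  moreover have "empirical U f x \<ge> 0" for x
    unfolding empirical_def by (simp add: sum_nonneg)
  ultimately show ?thesis by (auto simp: prob_vectors_def)
qed

lemma empirical_pos:
  assumes "u < U"
  shows "empirical U f (f u) > 0"
proof -
  have "(\<Sum>v<U. of_bool (f v = f u) :: real) \<ge> of_bool (f u = f u)"
    by (rule member_le_sum) (use assms in auto)
  then show ?thesis unfolding empirical_def using assms by (auto intro!: divide_pos_pos)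
qed

text \<open>Both bounds are \<open>code_entropy_ge\<close> for the letter laws that the code itself
  induces at each time: unconditioned with one class, and conditioned on the first message with
  \<open>U\<close> classes. For these laws the sum over message pairs is \<open>U^2\<close> times
  the entropy.\<close>

lemma code_out_entropy_ge:
  assumes g: "g \<in> {..<X} \<times> {..<X} \<rightarrow> {..<Y}" and U: "U > 0"
    and f: "f1 \<in> {..<U} \<rightarrow> words n {..<X}" "f2 \<in> {..<U} \<rightarrow> words n {..<X}"
    and R: "R \<subseteq> {..<U} \<times> {..<U}" "inj_on (\<lambda>d. channel_power n g (f1 (fst d), f2 (snd d))) R"
  shows "real (card R) * log 2 (real (card R)) \<le> real U ^ 2 *
    (\<Sum>i<n. out_entropy X g (empirical U (\<lambda>u. f1 u i)) (empirical U (\<lambda>u. f2 u i)))" (is ?out)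
   and "real (card R) * log 2 (real (card R) / real U) \<le> real U ^ 2 *
    (\<Sum>i<n. row_entropy X g (empirical U (\<lambda>u. f1 u i)) (empirical U (\<lambda>u. f2 u i)))" (is ?row)
proof -
  define a where "a i = empirical U (\<lambda>u. f1 u i)" for i
  define b where "b i = empirical U (\<lambda>u. f2 u i)" for i
  let ?D = "{..<U} \<times> {..<U}"
  let ?F = "\<lambda>d. channel_power n g (f1 (fst d), f2 (snd d))"
  have lt: "f1 u i < X" "f2 u i < X" if "u < U" "i < n" for u i
    using f that by (auto simp: words_def Pi_iff PiE_iff)
  have ab: "a i \<in> prob_vectors X" "b i \<in> prob_vectors X" if "i < n" for i
    unfolding a_def b_def using that lt U by (auto intro!: empirical_in_prob_vectors)
  have pos: "a i (f1 u i) > 0" "b i (f2 u i) > 0" if "u < U" for u i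
    unfolding a_def b_def using that empirical_pos[of u U "\<lambda>u. f1 u i"] empirical_pos[of u U "\<lambda>u. f2 u i"] by auto
  have F: "?F d \<in> words n {..<Y}" if "d \<in> ?D" for d
    using that lt g by (auto simp: channel_power_def words_def)
  have Fi: "?F d i = g (f1 (fst d) i, f2 (snd d) i)" if "i < n" for d i
    using that by (simp add: channel_power_def)
  \<comment> \<open>Independent messages give independent letters, so an average over message pairs
    is an expectation under the product of the two empirical laws.\<close>
  have avg: "(\<Sum>x1<X. a i x1 * (\<Sum>x2<X. b i x2 * \<psi> x1 x2)) =
     (\<Sum>d\<in>?D. \<psi> (f1 (fst d) i) (f2 (snd d) i)) / real U ^ 2" if "i < n" for i \<psi>
  proof -
    have "(\<Sum>x1<X. a i x1 * (\<Sum>x2<X. b i x2 * \<psi> x1 x2)) =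
      (\<Sum>x1<X. a i x1 * ((\<Sum>u2<U. \<psi> x1 (f2 u2 i)) / real U))"
      unfolding b_def using lt(2) that by (intro sum.cong refl arg_cong2[of _ _ _ _ "(*)"] sum_empirical) auto
    also have "\<dots> = (\<Sum>u1<U. (\<Sum>u2<U. \<psi> (f1 u1 i) (f2 u2 i)) / real U) / real U"
      unfolding a_def using lt(1) that by (intro sum_empirical) auto
    finally show ?thesis
      by (simp add: sum_divide_distrib sum.cartesian_product split_beta' power2_eq_square)
  qed
  have outavg: "out_entropy X g (a i) (b i) =
      (\<Sum>d\<in>?D. - log 2 (out_prob X g (a i) (b i) (g (f1 (fst d) i, f2 (snd d) i)))) / real U ^ 2"
    and rowavg: "row_entropy X g (a i) (b i) =
      (\<Sum>d\<in>?D. - log 2 (row_prob X g (b i) (f1 (fst d) i) (g (f1 (fst d) i, f2 (snd d) i)))) / real U ^ 2"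
    if "i < n" for i
    by (simp_all only: out_entropy_def row_entropy_def avg[OF that])
  have outpos: "out_prob X g (a i) (b i) (?F d i) > 0" if "d \<in> ?D" "i < n" for d i
  proof -
    have "0 < a i (f1 (fst d) i) * b i (f2 (snd d) i)" using pos that by auto
    also have "\<dots> \<le> out_prob X g (a i) (b i) (?F d i)"
      unfolding Fi[OF that(2)] using ab lt that by (intro out_prob_ge) auto
    finally show ?thesis .
  qed
  have rowpos: "row_prob X g (b i) (f1 (fst d) i) (?F d i) > 0" if "d \<in> ?D" "i < n" for d i
  proof -
    have "0 < b i (f2 (snd d) i)" using pos that by auto
    also have "\<dots> \<le> row_prob X g (b i) (f1 (fst d) i) (?F d i)"
      unfolding Fi[OF that(2)] using ab lt that by (intro row_prob_ge) auto
    finally show ?thesis .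
  qed
  \<comment> \<open>The value 0 from time \<open>n\<close> on keeps the weights nonnegative at all
    times: letters beyond the word length are unspecified, so the empirical laws there need not be
    probability vectors. The one-element type encodes trivial conditioning.\<close>
  define r where "r = (\<lambda>c::unit. \<lambda>i y. if i < n then out_prob X g (a i) (b i) y else 0)"
  define s where "s = (\<lambda>u i y. if i < n then row_prob X g (b i) (f1 u i) y else 0)"
  have ne: "?D \<noteq> {}" using U by auto
  have "real (card R) * log 2 (real (card R) / real (card ((\<lambda>_. ()) ` ?D)))
       \<le> (\<Sum>i<n. \<Sum>d\<in>?D. - log 2 (r () i (?F d i)))"
    by (rule code_entropy_ge[where Y = Y and \<kappa> = "\<lambda>_. ()"])
      (use R F ne outpos ab g in \<open>auto simp: r_def out_prob_nonneg out_prob_total\<close>)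
  also have "(\<lambda>_. ()) ` ?D = {()}" using ne by auto
  also have "(\<Sum>i<n. \<Sum>d\<in>?D. - log 2 (r () i (?F d i))) = real U ^ 2 * (\<Sum>i<n. out_entropy X g (a i) (b i))"
    unfolding sum_distrib_left
    by (intro sum.cong refl) (use U in \<open>simp add: outavg Fi r_def\<close>)
  finally show ?out by (simp add: a_def b_def)
  have "real (card R) * log 2 (real (card R) / real (card (fst ` ?D)))
       \<le> (\<Sum>i<n. \<Sum>d\<in>?D. - log 2 (s (fst d) i (?F d i)))"
    by (rule code_entropy_ge[where Y = Y])
      (use R F ne rowpos ab g lt in \<open>auto simp: s_def row_prob_nonneg row_prob_total\<close>)
  also have "fst ` ?D = {..<U}" using U by force
  also have "(\<Sum>i<n. \<Sum>d\<in>?D. - log 2 (s (fst d) i (?F d i))) = real U ^ 2 * (\<Sum>i<n. row_entropy X g (a i) (b i))"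
    unfolding sum_distrib_left
    by (intro sum.cong refl) (use U in \<open>simp add: rowavg Fi s_def\<close>)
  finally show ?row by (simp add: a_def b_def)
qed

section \<open>Compactness of the set of entropy triples\<close>

text \<open>The values \<open>H(y)\<close>, \<open>H(y|x1)\<close>, \<open>H(y|x2)\<close> for one
  fixed \<open>q\<close>.\<close>

definition entropy_triple :: "nat \<Rightarrow> (nat \<times> nat \<Rightarrow> nat) \<Rightarrow> (nat \<Rightarrow> real) \<times> (nat \<Rightarrow> real) \<Rightarrow> real \<times> real \<times> real" where
  "entropy_triple X g = (\<lambda>(a, b).
     (out_entropy X g a b, row_entropy X g a b, row_entropy X (g \<circ> prod.swap) b a))"

text \<open>A closed subset of a product of unit intervals and singletons, compact by Tychonoff's
  theorem.\<close>

lemma compact_prob_vectors: "compact (prob_vectors X)"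
proof -
  let ?B = "\<lambda>x. if x < X then {0..1::real} else {0}"
  have "compactin (product_topology (\<lambda>_. euclidean) UNIV) (PiE UNIV ?B)"
    unfolding compactin_PiE by auto
  then have "compact (PiE UNIV ?B)" by (simp add: euclidean_product_topology)
  moreover have "closed {a :: nat \<Rightarrow> real. (\<Sum>x<X. a x) = 1}"
    by (intro closed_Collect_eq continuous_on_sum continuous_on_product_coordinates continuous_on_const)
  moreover have "prob_vectors X = PiE UNIV ?B \<inter> {a. (\<Sum>x<X. a x) = 1}"
  proof (intro equalityI subsetI)
    fix a assume a: "a \<in> prob_vectors X"
    have "a x \<le> 1" if "x < X" for x
      using member_le_sum[of x "{..<X}" a] a that by (auto simp: prob_vectors_def)
    then show "a \<in> PiE UNIV ?B \<inter> {a. (\<Sum>x<X. a x) = 1}"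
      using a by (auto simp: prob_vectors_def)
  next
    fix a assume a: "a \<in> PiE UNIV ?B \<inter> {a. (\<Sum>x<X. a x) = 1}"
    then have "a x \<in> ?B x" for x by blast
    then have "0 \<le> a x" "x \<ge> X \<Longrightarrow> a x = 0" for x
      by (metis atLeastAtMost_iff empty_iff insert_iff order_refl, metis not_less singletonD)
    then show "a \<in> prob_vectors X" using a by (auto simp: prob_vectors_def)
  qed
  ultimately show ?thesis by (simp add: compact_Int_closed)
qed

text \<open>Only the point 0 needs care: there \<open>t log t\<close> tends to 0, which is also the
  value of \<open>neg_xlog\<close>.\<close>

lemma continuous_on_neg_xlog: "continuous_on {0..} neg_xlog"
proof -
  have "(neg_xlog \<longlongrightarrow> neg_xlog t) (at t within {0..})" if "t \<ge> 0" for t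
  proof (cases "t = 0")
    case True
    have "((\<lambda>t. t * - log 2 t) \<longlongrightarrow> 0) (at_right (0::real))" by real_asymp
    then show ?thesis using True by (simp add: neg_xlog_def[abs_def] at_within_Ici_at_right)
  next
    case False
    then have "isCont (\<lambda>t. t * - log 2 t) t" using that
      by (intro continuous_intros) auto
    then show ?thesis unfolding neg_xlog_def[abs_def] isCont_def by (rule tendsto_within_subset) auto
  qed
  then show ?thesis by (simp add: continuous_on_def)
qed

text \<open>The output form of the entropy is used: there the logarithm occurs only inside
  \<open>neg_xlog\<close>, which stays continuous when an output probability vanishes.\<close>

lemma continuous_on_row_entropy:
  assumes g: "g \<in> {..<X} \<times> {..<X} \<rightarrow> {..<Y}"
  shows "continuous_on (prob_vectors X \<times> prob_vectors X) (\<lambda>z. row_entropy X g (fst z) (snd z))"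
  unfolding row_entropy_eq[OF g]
proof (intro continuous_intros)
  show "continuous_on (prob_vectors X \<times> prob_vectors X) (\<lambda>z. fst z x)" for x
    by (rule continuous_on_product_then_coordinatewise[OF continuous_on_fst[OF continuous_on_id]])
  show "continuous_on (prob_vectors X \<times> prob_vectors X) (\<lambda>z. neg_xlog (row_prob X g (snd z) x y))" for x y
  proof (rule continuous_on_compose2[OF continuous_on_neg_xlog])
    show "continuous_on (prob_vectors X \<times> prob_vectors X) (\<lambda>z. row_prob X g (snd z) x y)"
      unfolding row_prob_def
      by (intro continuous_intros
          continuous_on_product_then_coordinatewise[OF continuous_on_snd[OF continuous_on_id]])
  qed (auto simp: row_prob_nonneg)
qed

lemma continuous_on_out_entropy:
  assumes g: "g \<in> {..<X} \<times> {..<X} \<rightarrow> {..<Y}"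
  shows "continuous_on (prob_vectors X \<times> prob_vectors X) (\<lambda>z. out_entropy X g (fst z) (snd z))"
  unfolding out_entropy_eq[OF g]
proof (intro continuous_on_sum continuous_on_compose2[OF continuous_on_neg_xlog])
  show "continuous_on (prob_vectors X \<times> prob_vectors X) (\<lambda>z. out_prob X g (fst z) (snd z) y)" for y
    unfolding row_prob_def out_prob_def
    by (intro continuous_intros
          continuous_on_product_then_coordinatewise[OF continuous_on_snd[OF continuous_on_id]]
          continuous_on_product_then_coordinatewise[OF continuous_on_fst[OF continuous_on_id]])
qed (auto simp: out_prob_nonneg)

lemma compact_entropy_triples:
  assumes g: "g \<in> {..<X} \<times> {..<X} \<rightarrow> {..<Y}"
  shows "compact (entropy_triple X g ` (prob_vectors X \<times> prob_vectors X))"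
proof (rule compact_continuous_image)
  have g': "g \<circ> prod.swap \<in> {..<X} \<times> {..<X} \<rightarrow> {..<Y}" using g by auto
  have "continuous_on (prob_vectors X \<times> prob_vectors X) (\<lambda>z. row_entropy X (g \<circ> prod.swap) (snd z) (fst z))"
    using continuous_on_compose2[OF continuous_on_row_entropy[OF g'] continuous_on_swap,
        of "prob_vectors X \<times> prob_vectors X"] by (simp add: product_swap)
  then show "continuous_on (prob_vectors X \<times> prob_vectors X) (entropy_triple X g)"
    unfolding entropy_triple_def split_beta'
    by (intro continuous_on_Pair continuous_on_row_entropy[OF g] continuous_on_out_entropy[OF g])
qed (intro compact_Times compact_prob_vectors)

section \<open>Positivity of entropies\<close>

lemma sum_neg_xlog_nonneg:
  assumes "\<And>y. p y \<ge> 0" "(\<Sum>y<Y::nat. p y) = 1"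
  shows "(\<Sum>y<Y. neg_xlog (p y)) \<ge> 0"
proof (rule sum_nonneg)
  fix y assume "y \<in> {..<Y}"
  then have "p y \<le> 1" using member_le_sum[of y "{..<Y}" p] assms by auto
  then show "neg_xlog (p y) \<ge> 0" using assms(1)[of y]
    by (cases "p y = 0") (auto simp: neg_xlog_def mult_nonneg_nonpos)
qed

text \<open>The mass at \<open>y'\<close> leaves less than one for \<open>y\<close>, so the term of
  \<open>y\<close> is strictly positive and the others are nonnegative.\<close>

lemma sum_neg_xlog_pos:
  assumes p: "\<And>y. p y \<ge> 0" "(\<Sum>y<Y::nat. p y) = 1" and y: "y < Y" "y' < Y" "y \<noteq> y'" "p y > 0" "p y' > 0"
  shows "(\<Sum>y<Y. neg_xlog (p y)) > 0"
proof (rule sum_pos2)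
  have "p y + p y' = sum p {y, y'}" using y by simp
  also have "\<dots> \<le> 1" unfolding p(2)[symmetric] by (rule sum_mono2) (use p y in auto)
  finally have "p y < 1" using y by simp
  then show "neg_xlog (p y) > 0" using y by (simp add: neg_xlog_def mult_pos_neg)
  fix z assume "z \<in> {..<Y}"
  then have "p z \<le> 1" using member_le_sum[of z "{..<Y}" p] p by auto
  then show "neg_xlog (p z) \<ge> 0" using p(1)[of z]
    by (cases "p z = 0") (auto simp: neg_xlog_def mult_nonneg_nonpos)
qed (use y in auto)

text \<open>With full support, two different entries in row \<open>x1\<close> give two outputs of
  positive probability, both overall and within that row.\<close>

lemma out_row_entropy_pos:
  assumes g: "g \<in> {..<X} \<times> {..<X} \<rightarrow> {..<Y}"
    and ab: "a \<in> prob_vectors X" "b \<in> prob_vectors X"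
    and pos: "\<And>x. x < X \<Longrightarrow> a x > 0" "\<And>x. x < X \<Longrightarrow> b x > 0"
    and x: "x1 < X" "x2 < X" "x2' < X" and ne: "g (x1, x2) \<noteq> g (x1, x2')"
  shows "out_entropy X g a b > 0" "row_entropy X g a b > 0"
proof -
  have gY: "g (x1, x2) < Y" "g (x1, x2') < Y" using g x by auto
  have "out_prob X g a b (g (x1, z)) > 0" "row_prob X g b x1 (g (x1, z)) > 0" if "z < X" for z
    using out_prob_ge[OF ab x(1) that, of g] row_prob_ge[OF ab(2) that, of g x1] pos x(1) that
    by (meson less_le_trans mult_pos_pos)+
  note p = this[OF x(2)] this[OF x(3)]
  show "out_entropy X g a b > 0" unfolding out_entropy_eq[OF g]
    by (rule sum_neg_xlog_pos[OF _ _ gY ne]) (use out_prob_nonneg ab out_prob_total g p in auto)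
  show "row_entropy X g a b > 0" unfolding row_entropy_eq[OF g]
  proof (rule sum_pos2[of _ x1])
    show "a x1 * (\<Sum>y<Y. neg_xlog (row_prob X g b x1 y)) > 0"
      by (intro mult_pos_pos sum_neg_xlog_pos[OF _ _ gY ne] pos)
        (use row_prob_nonneg ab row_prob_total g p x in auto)
    show "a z * (\<Sum>y<Y. neg_xlog (row_prob X g b z y)) \<ge> 0" if "z \<in> {..<X}" for z
      using that ab g
      by (intro mult_nonneg_nonneg sum_neg_xlog_nonneg row_prob_nonneg row_prob_total)
        (auto simp: prob_vectors_def)
  qed (use x in auto)
qed

section \<open>Conditional entropies of the joint distribution\<close>

lemma exists_pmf:
  fixes f :: "'a \<Rightarrow> real"
  assumes "finite A" "\<And>x. f x \<ge> 0" "\<And>x. x \<notin> A \<Longrightarrow> f x = 0" "sum f A = 1"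
  shows "\<exists>p. pmf p = f"
proof -
  have "(\<integral>\<^sup>+x. ennreal (f x) \<partial>count_space UNIV) = (\<Sum>x\<in>A. ennreal (f x))"
    by (rule nn_integral_count_space'[OF assms(1)]) (use assms in auto)
  also have "\<dots> = 1" using assms by (simp add: sum_ennreal)
  finally have "pmf (embed_pmf f) = f" using assms by (auto simp: pmf_embed_pmf)
  then show ?thesis by blast
qed

lemma pmf_map_joint_pmf:
  assumes Q: "finite Q" "set_pmf pq \<subseteq> Q"
    and p: "\<And>q. set_pmf (p1 q) \<subseteq> {..<X}" "\<And>q. set_pmf (p2 q) \<subseteq> {..<X::nat}"
  shows "pmf (map_pmf f (joint_pmf pq p1 p2 g)) z = (\<Sum>q\<in>Q. pmf pq q * (\<Sum>x1<X. pmf (p1 q) x1 *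
     (\<Sum>x2<X. pmf (p2 q) x2 * of_bool (f (q, x1, x2, g (x1, x2)) = z))))"
proof -
  have bind: "pmf (bind_pmf p h) z = (\<Sum>a\<in>A. pmf p a * pmf (h a) z)"
    if "finite A" "set_pmf p \<subseteq> A" for p :: "'x pmf" and h :: "'x \<Rightarrow> 'y pmf" and A and z
    unfolding pmf_bind by (subst integral_measure_pmf_real[OF that(1)]) (use that in \<open>auto simp: mult.commute\<close>)
  show ?thesis unfolding joint_pmf_def map_bind_pmf map_return_pmf
    by (simp add: bind[OF Q] bind[OF finite_lessThan p(1)] bind[OF finite_lessThan p(2)]
       indicator_def of_bool_def eq_commute)
qed

text \<open>Here \<open>w\<close> is the law of the condition and \<open>c t\<close> the conditional
  law. Where \<open>w t = 0\<close> the choice of \<open>c t\<close> does not affect the sum, and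
  \<open>A\<close>, \<open>B\<close> may exceed the supports since points of mass zero contribute
  nothing.\<close>

lemma cond_entropy_eq_neg_xlog:
  fixes S :: "'a \<Rightarrow> 'b :: countable" and T :: "'a \<Rightarrow> 'c :: countable"
  assumes fin: "finite (set_pmf p)" "finite A" "finite B"
    and sub: "S ` set_pmf p \<subseteq> A" "T ` set_pmf p \<subseteq> B"
    and joint: "\<And>s t. s \<in> A \<Longrightarrow> t \<in> B \<Longrightarrow> pmf (map_pmf (\<lambda>\<omega>. (S \<omega>, T \<omega>)) p) (s, t) = w t * c t s"
    and marg: "\<And>t. t \<in> B \<Longrightarrow> pmf (map_pmf T p) t = w t"
  shows "cond_entropy p S T = (\<Sum>t\<in>B. w t * (\<Sum>s\<in>A. neg_xlog (c t s)))"
proof -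
  let ?J = "map_pmf (\<lambda>\<omega>. (S \<omega>, T \<omega>)) p"
  have "cond_entropy p S T = - (\<Sum>(s, t)\<in>set_pmf ?J. pmf ?J (s, t) * log 2 (pmf ?J (s, t) / pmf (map_pmf T p) t))"
    using cond_entropy_eq_sum[OF fin(1), of S T] by simp
  also have "\<dots> = - (\<Sum>(s, t)\<in>A \<times> B. pmf ?J (s, t) * log 2 (pmf ?J (s, t) / pmf (map_pmf T p) t))"
  proof (rule arg_cong[of _ _ uminus], rule sum.mono_neutral_left)
    show "\<forall>z\<in>A \<times> B - set_pmf ?J. (case z of (s, t) \<Rightarrow> pmf ?J (s, t) * log 2 (pmf ?J (s, t) / pmf (map_pmf T p) t)) = 0"
      by (auto simp: pmf_eq_0_set_pmf simp del: set_map_pmf)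
  qed (use fin sub in auto)
  also have "\<dots> = - (\<Sum>(s, t)\<in>A \<times> B. w t * (c t s * log 2 (c t s)))"
    by (intro arg_cong[of _ _ uminus] sum.cong refl) (auto simp: joint marg)
  also have "\<dots> = (\<Sum>t\<in>B. w t * (\<Sum>s\<in>A. neg_xlog (c t s)))"
    unfolding neg_xlog_def sum.cartesian_product[symmetric] sum_distrib_left
    by (subst sum.swap) (simp add: sum_negf)
  finally show ?thesis .
qed

text \<open>Given \<open>q\<close>, the output has law \<open>out_prob\<close>; given
  \<open>q\<close> and one input, it has law \<open>row_prob\<close>. Hence the entropies of the
  joint distribution are mixtures over \<open>q\<close> of the components of
  \<open>entropy_triple\<close>.\<close>

lemma joint_pmf_cond_entropies:
  fixes pq :: "nat pmf" and g :: "nat \<times> nat \<Rightarrow> nat"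
  assumes g: "g \<in> {..<X} \<times> {..<X} \<rightarrow> {..<Y}" and Q: "finite Q" "set_pmf pq \<subseteq> Q"
    and p: "\<And>q. set_pmf (p1 q) \<subseteq> {..<X}" "\<And>q. set_pmf (p2 q) \<subseteq> {..<X}"
  defines "J \<equiv> joint_pmf pq p1 p2 g"
  shows "cond_entropy J (\<lambda>(q, x1, x2, y). y) (\<lambda>(q, x1, x2, y). q) =
      (\<Sum>q\<in>Q. pmf pq q * out_entropy X g (pmf (p1 q)) (pmf (p2 q)))" (is ?out)
    and "cond_entropy J (\<lambda>(q, x1, x2, y). y) (\<lambda>\<omega>. ((\<lambda>(q, x1, x2, y). x1) \<omega>, (\<lambda>(q, x1, x2, y). q) \<omega>)) =
      (\<Sum>q\<in>Q. pmf pq q * row_entropy X g (pmf (p1 q)) (pmf (p2 q)))" (is ?row)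
    and "cond_entropy J (\<lambda>(q, x1, x2, y). y) (\<lambda>\<omega>. ((\<lambda>(q, x1, x2, y). x2) \<omega>, (\<lambda>(q, x1, x2, y). q) \<omega>)) =
      (\<Sum>q\<in>Q. pmf pq q * row_entropy X (g \<circ> prod.swap) (pmf (p2 q)) (pmf (p1 q)))" (is ?col)
proof -
  have J: "set_pmf J \<subseteq> (\<lambda>(q, x1, x2). (q, x1, x2, g (x1, x2))) ` (Q \<times> {..<X} \<times> {..<X})"
  proof
    fix z assume "z \<in> set_pmf J"
    then obtain q x1 x2 where q: "q \<in> set_pmf pq" "x1 \<in> set_pmf (p1 q)" "x2 \<in> set_pmf (p2 q)"
      and z: "z = (q, x1, x2, g (x1, x2))"
      unfolding J_def joint_pmf_def by auto
    have "(q, x1, x2) \<in> Q \<times> {..<X} \<times> {..<X}"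
      using q(1) subsetD[OF p(1) q(2)] subsetD[OF p(2) q(3)] Q by auto
    then show "z \<in> (\<lambda>(q, x1, x2). (q, x1, x2, g (x1, x2))) ` (Q \<times> {..<X} \<times> {..<X})"
      using z by (intro image_eqI[of _ _ "(q, x1, x2)"]) auto
  qed
  have finJ: "finite (set_pmf J)" by (rule finite_subset[OF J]) (use Q in auto)
  have mem: "q \<in> Q \<and> x1 < X \<and> x2 < X \<and> y < Y" if "(q, x1, x2, y) \<in> set_pmf J" for q x1 x2 y
    using subsetD[OF J that] g by auto
  have one: "(\<Sum>x<X. pmf (p1 q) x) = 1" "(\<Sum>x<X. pmf (p2 q) x) = 1" for q
    using sum_pmf_eq_1[OF finite_lessThan p(1)] sum_pmf_eq_1[OF finite_lessThan p(2)] by auto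
  have g': "g \<circ> prod.swap \<in> {..<X} \<times> {..<X} \<rightarrow> {..<Y}" using g by auto
  have sel: "(\<Sum>x\<in>A. f x * (if x = c then h x else 0)) = f c * h c" if "finite A" "c \<in> A"
    for A and c :: nat and f h :: "nat \<Rightarrow> real"
    using that by (simp add: if_distrib[of "(*) _"] cong: if_cong)
  have pm: "pmf (map_pmf f J) z = (\<Sum>q\<in>Q. pmf pq q * (\<Sum>x1<X. pmf (p1 q) x1 *
     (\<Sum>x2<X. pmf (p2 q) x2 * of_bool (f (q, x1, x2, g (x1, x2)) = z))))"
    for f :: "nat \<times> nat \<times> nat \<times> nat \<Rightarrow> 'z" and z
    unfolding J_def by (rule pmf_map_joint_pmf[OF Q p])
  show ?out unfolding out_entropy_eq[OF g]
  proof (rule cond_entropy_eq_neg_xlog[OF finJ finite_lessThan Q(1)])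
    fix s t :: nat assume t: "t \<in> Q"
    have "pmf (map_pmf (\<lambda>\<omega>. (case \<omega> of (q, x1, x2, y) \<Rightarrow> y, case \<omega> of (q, x1, x2, y) \<Rightarrow> q)) J) (s, t)
      = (\<Sum>q\<in>Q. pmf pq q * (if q = t then out_prob X g (pmf (p1 q)) (pmf (p2 q)) s else 0))"
      unfolding pm by (intro sum.cong refl) (simp add: out_prob_def row_prob_def)
    then show "pmf (map_pmf (\<lambda>\<omega>. (case \<omega> of (q, x1, x2, y) \<Rightarrow> y, case \<omega> of (q, x1, x2, y) \<Rightarrow> q)) J) (s, t)
      = pmf pq t * out_prob X g (pmf (p1 t)) (pmf (p2 t)) s" using sel[OF Q(1) t] by simp
  next
    fix t :: nat assume t: "t \<in> Q"
    have "pmf (map_pmf (\<lambda>(q, x1, x2, y). q) J) t = (\<Sum>q\<in>Q. pmf pq q * (if q = t then 1 else 0))"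
      unfolding pm by (intro sum.cong refl) (simp add: one)
    then show "pmf (map_pmf (\<lambda>(q, x1, x2, y). q) J) t = pmf pq t" using sel[OF Q(1) t] by simp
  qed (use mem in auto)
  have "cond_entropy J (\<lambda>(q, x1, x2, y). y) (\<lambda>\<omega>. ((\<lambda>(q, x1, x2, y). x1) \<omega>, (\<lambda>(q, x1, x2, y). q) \<omega>)) =
     (\<Sum>t\<in>{..<X} \<times> Q. (pmf pq (snd t) * pmf (p1 (snd t)) (fst t)) *
       (\<Sum>y<Y. neg_xlog (row_prob X g (pmf (p2 (snd t))) (fst t) y)))"
  proof (rule cond_entropy_eq_neg_xlog[OF finJ finite_lessThan])
    fix s :: nat and t :: "nat \<times> nat" assume t: "t \<in> {..<X} \<times> Q"
    have "pmf (map_pmf (\<lambda>\<omega>. (case \<omega> of (q, x1, x2, y) \<Rightarrow> y, case \<omega> of (q, x1, x2, y) \<Rightarrow> x1, case \<omega> of (q, x1, x2, y) \<Rightarrow> q)) J) (s, t)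
      = (\<Sum>q\<in>Q. pmf pq q * (if q = snd t then \<Sum>x1<X. pmf (p1 q) x1 * (if x1 = fst t then row_prob X g (pmf (p2 q)) x1 s else 0) else 0))"
      unfolding pm by (intro sum.cong refl) (auto simp: row_prob_def prod_eq_iff intro!: sum.cong)
    then show "pmf (map_pmf (\<lambda>\<omega>. (case \<omega> of (q, x1, x2, y) \<Rightarrow> y, case \<omega> of (q, x1, x2, y) \<Rightarrow> x1, case \<omega> of (q, x1, x2, y) \<Rightarrow> q)) J) (s, t)
      = (pmf pq (snd t) * pmf (p1 (snd t)) (fst t)) * row_prob X g (pmf (p2 (snd t))) (fst t) s"
      using t by (auto simp: sel Q)
  next
    fix t :: "nat \<times> nat" assume t: "t \<in> {..<X} \<times> Q"
    have "pmf (map_pmf (\<lambda>\<omega>. (case \<omega> of (q, x1, x2, y) \<Rightarrow> x1, case \<omega> of (q, x1, x2, y) \<Rightarrow> q)) J) t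
      = (\<Sum>q\<in>Q. pmf pq q * (if q = snd t then \<Sum>x1<X. pmf (p1 q) x1 * (if x1 = fst t then 1 else 0) else 0))"
      unfolding pm by (intro sum.cong refl) (auto simp: one prod_eq_iff intro!: sum.cong)
    then show "pmf (map_pmf (\<lambda>\<omega>. (case \<omega> of (q, x1, x2, y) \<Rightarrow> x1, case \<omega> of (q, x1, x2, y) \<Rightarrow> q)) J) t
       = pmf pq (snd t) * pmf (p1 (snd t)) (fst t)"
      using t by (auto simp: sel Q)
  qed (use mem Q in auto)
  also have "\<dots> = (\<Sum>x\<in>{..<X}. \<Sum>q\<in>Q. pmf pq q * (pmf (p1 q) x * (\<Sum>y<Y. neg_xlog (row_prob X g (pmf (p2 q)) x y))))"
    by (simp add: sum.cartesian_product split_beta' mult.assoc)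
  finally show ?row unfolding row_entropy_eq[OF g] by (subst (asm) sum.swap) (simp add: sum_distrib_left)
  have "cond_entropy J (\<lambda>(q, x1, x2, y). y) (\<lambda>\<omega>. ((\<lambda>(q, x1, x2, y). x2) \<omega>, (\<lambda>(q, x1, x2, y). q) \<omega>)) =
     (\<Sum>t\<in>{..<X} \<times> Q. (pmf pq (snd t) * pmf (p2 (snd t)) (fst t)) *
       (\<Sum>y<Y. neg_xlog (row_prob X (g \<circ> prod.swap) (pmf (p1 (snd t))) (fst t) y)))"
  proof (rule cond_entropy_eq_neg_xlog[OF finJ finite_lessThan])
    \<comment> \<open>With the sum over \<open>x2\<close> outside, the second user takes the place
      of the first and the channel becomes \<open>g \<circ> prod.swap\<close>.\<close>
    have pm': "pmf (map_pmf f J) z = (\<Sum>q\<in>Q. pmf pq q * (\<Sum>x2<X. pmf (p2 q) x2 *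
        (\<Sum>x1<X. pmf (p1 q) x1 * of_bool (f (q, x1, x2, g (x1, x2)) = z))))"
      for f :: "_ \<Rightarrow> 'z" and z
      unfolding pm sum_distrib_left
      by (rule sum.cong[OF refl], subst sum.swap) (simp add: mult_ac)
    fix t :: "nat \<times> nat" assume t: "t \<in> {..<X} \<times> Q"
    {
      fix s :: nat
      have "pmf (map_pmf (\<lambda>\<omega>. (case \<omega> of (q, x1, x2, y) \<Rightarrow> y, case \<omega> of (q, x1, x2, y) \<Rightarrow> x2, case \<omega> of (q, x1, x2, y) \<Rightarrow> q)) J) (s, t)
        = (\<Sum>q\<in>Q. pmf pq q * (if q = snd t then \<Sum>x2<X. pmf (p2 q) x2 * (if x2 = fst t then row_prob X (g \<circ> prod.swap) (pmf (p1 q)) x2 s else 0) else 0))"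
        unfolding pm' by (intro sum.cong refl) (auto simp: row_prob_def prod_eq_iff intro!: sum.cong)
      then show "pmf (map_pmf (\<lambda>\<omega>. (case \<omega> of (q, x1, x2, y) \<Rightarrow> y, case \<omega> of (q, x1, x2, y) \<Rightarrow> x2, case \<omega> of (q, x1, x2, y) \<Rightarrow> q)) J) (s, t)
        = (pmf pq (snd t) * pmf (p2 (snd t)) (fst t)) * row_prob X (g \<circ> prod.swap) (pmf (p1 (snd t))) (fst t) s"
        using t by (auto simp: sel Q)
    }
    have "pmf (map_pmf (\<lambda>\<omega>. (case \<omega> of (q, x1, x2, y) \<Rightarrow> x2, case \<omega> of (q, x1, x2, y) \<Rightarrow> q)) J) t
      = (\<Sum>q\<in>Q. pmf pq q * (if q = snd t then \<Sum>x2<X. pmf (p2 q) x2 * (if x2 = fst t then 1 else 0) else 0))"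
      unfolding pm' by (intro sum.cong refl) (auto simp: one prod_eq_iff intro!: sum.cong)
    then show "pmf (map_pmf (\<lambda>\<omega>. (case \<omega> of (q, x1, x2, y) \<Rightarrow> x2, case \<omega> of (q, x1, x2, y) \<Rightarrow> q)) J) t
       = pmf pq (snd t) * pmf (p2 (snd t)) (fst t)"
      using t by (auto simp: sel Q)
  qed (use mem Q in auto)
  also have "\<dots> = (\<Sum>x\<in>{..<X}. \<Sum>q\<in>Q. pmf pq q * (pmf (p2 q) x * (\<Sum>y<Y. neg_xlog (row_prob X (g \<circ> prod.swap) (pmf (p1 q)) x y))))"
    by (simp add: sum.cartesian_product split_beta' mult.assoc)
  finally show ?col unfolding row_entropy_eq[OF g'] by (subst (asm) sum.swap) (simp add: sum_distrib_left)
qed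

section \<open>A criterion for the exponential inequality\<close>

text \<open>The ratio of logarithms equals \<open>n U * c / log 2 U\<close>, which eventually is at
  least \<open>s * \<eta>\<close> for every \<open>\<eta> < 1\<close>.\<close>

lemma dot_leI:
  assumes s: "s > 0" and c: "s * l \<le> c"
    and ev: "\<And>\<eta>. \<eta> < 1 \<Longrightarrow> \<forall>\<^sub>F U in sequentially. \<eta> * log 2 (real U) \<le> real (n U) * l"
  shows "dot_le s (\<lambda>U. 2 powr (real (n U) * c))"
  unfolding dot_le_def le_Liminf_iff
proof (intro allI impI)
  fix y assume "y < ereal s"
  \<comment> \<open>The bound \<open>y\<close> may be minus infinity, so a real number between it
    and \<open>s\<close> replaces it.\<close>
  then obtain z where z: "y < ereal z" "z < s"
    using ereal_dense2 by (metis ereal_less_ereal_Ex less_ereal.simps(1))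
  \<comment> \<open>The midpoint of \<open>z / s\<close> and 1.\<close>
  define \<eta> where "\<eta> = (z / s + 1) / 2"
  have \<eta>: "\<eta> < 1" "z / s < \<eta>" using z s by (auto simp: \<eta>_def field_simps)
  show "\<forall>\<^sub>F U in sequentially. y < ereal (log 2 (2 powr (real (n U) * c)) / log 2 (real U))"
    using ev[OF \<eta>(1)] eventually_ge_at_top[of 2]
  proof eventually_elim
    case (elim U)
    have lU: "log 2 (real U) > 0" using elim by simp
    have "z * log 2 (real U) < s * (\<eta> * log 2 (real U))"
      using \<eta>(2) s lU by (simp add: field_simps)
    also have "\<dots> \<le> s * (real (n U) * l)" using elim s by simp
    also have "\<dots> \<le> real (n U) * c" using mult_left_mono[OF c, of "real (n U)"] by (simp add: mult_ac)
    finally have "z < real (n U) * c / log 2 (real U)" using lU by (simp add: field_simps)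
    then show ?case using z(1) by (simp add: less_trans[of y "ereal z"])
  qed
qed

subsection \<open>Feasible sequences\<close>

text \<open>Once \<open>W powr \<epsilon> \<ge> 2 * C\<close>, the base is at most 1/2 and the power
  at most \<open>(1/2)^U\<close>.\<close>

lemma power_below_eventually:
  fixes \<epsilon> :: real
  assumes W: "filterlim W at_top sequentially" and \<epsilon>: "\<epsilon> > 0" and c: "c > 0" "C > 0"
  shows "\<forall>\<^sub>F U in sequentially. (C / real (W U) powr \<epsilon>) ^ (U ^ 2) < c"
proof -
  have "filterlim (\<lambda>U. real (W U)) at_top sequentially"
    by (rule filterlim_compose[OF filterlim_real_sequentially W])
  moreover have "filterlim (\<lambda>x::real. x powr \<epsilon>) at_top at_top" using \<epsilon> by real_asymp
  ultimately have "filterlim (\<lambda>U. real (W U) powr \<epsilon>) at_top sequentially"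
    by (rule filterlim_compose[rotated])
  then have "\<forall>\<^sub>F U in sequentially. real (W U) powr \<epsilon> \<ge> 2 * C"
    by (simp add: filterlim_at_top)
  moreover have "(\<lambda>U. (1 / 2 :: real) ^ U) \<longlonglongrightarrow> 0" by (rule LIMSEQ_power_zero) simp
  then have "\<forall>\<^sub>F U in sequentially. (1 / 2 :: real) ^ U < c"
    using c by (simp add: order_tendsto_iff)
  ultimately show ?thesis
  proof eventually_elim
    case (elim U)
    have pos: "real (W U) powr \<epsilon> > 0" using elim c by linarith
    have "(C / real (W U) powr \<epsilon>) ^ (U ^ 2) \<le> (1 / 2) ^ (U ^ 2)"
      by (rule power_mono) (use elim pos c in \<open>auto simp: field_simps\<close>)
    also have "\<dots> \<le> (1 / 2) ^ U" by (rule power_decreasing) (auto simp: power2_eq_square)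
    also have "\<dots> < c" using elim by simp
    finally show ?case .
  qed
qed

locale feasible_sequence =
  fixes X Y :: nat and g :: "nat \<times> nat \<Rightarrow> nat"
    and W n :: "nat \<Rightarrow> nat" and \<delta> :: "nat \<Rightarrow> real" and L :: real
  assumes X: "X \<ge> 2"
    and g: "g \<in> {..<X} \<times> {..<X} \<rightarrow> {..<Y}"
    and W: "\<And>U. U \<ge> 2 \<Longrightarrow> 2 \<le> W U"
    and W_lim: "filterlim W at_top sequentially"
    and \<delta>: "\<And>U. U \<ge> 2 \<Longrightarrow> \<delta> U \<le> 1 / (2 * ln (real (W U)))"
    and n_pos: "\<And>U. U \<ge> 2 \<Longrightarrow> n U > 0"
    and lim: "(\<lambda>U. real (card {a \<in> target_functions U (W U).
                feasible U (W U) (words (n U) {..<X}) (words (n U) {..<Y}) (\<delta> U)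
                  a (channel_power (n U) g)})
            / real (card (target_functions U (W U)))) \<longlonglongrightarrow> L"
    and L_pos: "L > 0"
begin

definition code_output :: "nat \<Rightarrow> (nat \<Rightarrow> nat \<Rightarrow> nat) \<Rightarrow> (nat \<Rightarrow> nat \<Rightarrow> nat) \<Rightarrow> nat \<times> nat \<Rightarrow> nat \<Rightarrow> nat" where
  "code_output U f1 f2 d = channel_power (n U) g (f1 (fst d), f2 (snd d))"

lemma word_less: "f \<in> {..<U} \<rightarrow> words m {..<X} \<Longrightarrow> u < U \<Longrightarrow> i < m \<Longrightarrow> f u i < X"
  by (auto simp: words_def Pi_iff PiE_iff)

lemma code_output_in_words:
  assumes "f1 \<in> {..<U} \<rightarrow> words (n U) {..<X}" "f2 \<in> {..<U} \<rightarrow> words (n U) {..<X}" "d \<in> {..<U} \<times> {..<U}"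
  shows "code_output U f1 f2 d \<in> words (n U) {..<Y}"
  using assms(3) word_less[OF assms(1)] word_less[OF assms(2)] g
  by (auto simp: code_output_def channel_power_def words_def)

text \<open>If all labels took few values, the feasible fraction would fall below
  \<open>L / 2\<close>, while it eventually exceeds \<open>L / 2\<close>. The threshold on
  \<open>U\<close> does not depend on the label set \<open>S\<close>.\<close>

lemma labels_not_few:
  fixes \<epsilon> :: real
  assumes \<epsilon>: "\<epsilon> > 0"
  shows "\<forall>\<^sub>F U in sequentially. \<forall>S :: (nat \<times> nat \<Rightarrow> 'l) set.
    finite S \<longrightarrow> real (card S) \<le> exp (real U ^ 2) \<longrightarrow>
    (\<forall>f1 f2. f1 \<in> {..<U} \<rightarrow> words (n U) {..<X} \<longrightarrow> f2 \<in> {..<U} \<rightarrow> words (n U) {..<X} \<longrightarrow>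
      (\<exists>l\<in>S. \<exists>\<psi>. \<forall>d\<in>{..<U} \<times> {..<U}. \<psi> (l d) = code_output U f1 f2 d)) \<longrightarrow>
    (\<exists>l\<in>S. real (card (l ` ({..<U} \<times> {..<U}))) > (1 - \<epsilon>) * real U ^ 2)"
proof -
  have "\<forall>\<^sub>F U in sequentially. (2 * exp (3/2) / real (W U) powr \<epsilon>) ^ (U ^ 2) < L / 2"
    by (rule power_below_eventually[OF W_lim \<epsilon>]) (use L_pos in auto)
  moreover have "\<forall>\<^sub>F U in sequentially. L / 2 < real (card {a \<in> target_functions U (W U).
                feasible U (W U) (words (n U) {..<X}) (words (n U) {..<Y}) (\<delta> U)
                  a (channel_power (n U) g)})
            / real (card (target_functions U (W U)))"
    by (rule order_tendstoD[OF lim]) (use L_pos in simp)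
  ultimately show ?thesis using eventually_ge_at_top[of 2]
  proof eventually_elim
    case (elim U)
    show ?case
    proof (intro allI impI, rule ccontr)
      fix S :: "(nat \<times> nat \<Rightarrow> 'l) set"
      assume S: "finite S" "real (card S) \<le> exp (real U ^ 2)"
        and lab: "\<forall>f1 f2. f1 \<in> {..<U} \<rightarrow> words (n U) {..<X} \<longrightarrow> f2 \<in> {..<U} \<rightarrow> words (n U) {..<X} \<longrightarrow>
          (\<exists>l\<in>S. \<exists>\<psi>. \<forall>d\<in>{..<U} \<times> {..<U}. \<psi> (l d) = code_output U f1 f2 d)"
        and few: "\<not> (\<exists>l\<in>S. real (card (l ` ({..<U} \<times> {..<U}))) > (1 - \<epsilon>) * real U ^ 2)"
      have "real (card {a \<in> target_functions U (W U).
                feasible U (W U) (words (n U) {..<X}) (words (n U) {..<Y}) (\<delta> U)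
                  a (channel_power (n U) g)})
            / real (card (target_functions U (W U))) \<le> (2 * exp (3/2) / real (W U) powr \<epsilon>) ^ (U ^ 2)"
      proof (rule feasible_fraction_le[where L = S])
        fix f1 f2 \<phi>
        assume f: "f1 \<in> {..<U} \<rightarrow> words (n U) {..<X}" "f2 \<in> {..<U} \<rightarrow> words (n U) {..<X}"
          and \<phi>: "\<phi> \<in> words (n U) {..<Y} \<rightarrow> {..<W U}"
        obtain l \<psi> where l: "l \<in> S" and \<psi>: "\<forall>d\<in>{..<U} \<times> {..<U}. \<psi> (l d) = code_output U f1 f2 d"
          using lab f by blast
        have "(\<phi> \<circ> \<psi>) (l d) = \<phi> (channel_power (n U) g (f1 (fst d), f2 (snd d)))
            \<and> (\<phi> \<circ> \<psi>) (l d) < W U" if "d \<in> {..<U} \<times> {..<U}" for d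
          using bspec[OF \<psi> that] funcset_mem[OF \<phi> code_output_in_words[OF f that]]
          by (simp add: code_output_def)
        then show "\<exists>l\<in>S. \<exists>\<psi>. \<forall>d\<in>{..<U} \<times> {..<U}.
            \<psi> (l d) = \<phi> (channel_power (n U) g (f1 (fst d), f2 (snd d))) \<and> \<psi> (l d) < W U"
          using l by blast
      qed (use S few elim W \<delta> in \<open>auto simp: not_less\<close>)
      then show False using elim by linarith
    qed
  qed
qed

text \<open>The labels are the output maps of all codes. There are at most \<open>X^(2 n U)\<close>
  of them, and the length condition says exactly that this number is at most
  \<open>exp (U^2)\<close>.\<close>

lemma good_code:
  fixes \<epsilon> :: real
  assumes \<epsilon>: "\<epsilon> > 0"
  shows "\<forall>\<^sub>F U in sequentially. 2 * real (n U) * ln (real X) \<le> real U \<longrightarrow>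
    (\<exists>f1 f2. f1 \<in> {..<U} \<rightarrow> words (n U) {..<X} \<and> f2 \<in> {..<U} \<rightarrow> words (n U) {..<X} \<and>
      real (card (code_output U f1 f2 ` ({..<U} \<times> {..<U}))) > (1 - \<epsilon>) * real U ^ 2)"
  using labels_not_few[OF \<epsilon>, where 'l = "nat \<Rightarrow> nat"] eventually_ge_at_top[of 2]
proof eventually_elim
  case (elim U)
  show ?case
  proof
    assume small: "2 * real (n U) * ln (real X) \<le> real U"
    \<comment> \<open>Extensional encoders make the family of codes finite; restricting an encoder
      to the messages does not change the outputs on message pairs.\<close>
    let ?P = "{..<U} \<rightarrow>\<^sub>E words (n U) {..<X}"
    let ?S = "(\<lambda>(f1, f2). code_output U f1 f2) ` (?P \<times> ?P)"
    have finP: "finite ?P" by (intro finite_PiE) (auto simp: finite_words)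
    have "card ?S \<le> card (?P \<times> ?P)" by (rule card_image_le) (use finP in auto)
    also have "\<dots> = X ^ (2 * n U * U)"
    proof -
      have "2 * n U * U = n U * U + n U * U" by simp
      then show ?thesis by (simp only: card_cartesian_product) (simp add: card_PiE card_words power_mult power_add)
    qed
    finally have "real (card ?S) \<le> real X ^ (2 * n U * U)" by (metis of_nat_le_iff of_nat_power)
    also have "\<dots> = exp (real U * (2 * real (n U) * ln (real X)))"
    proof -
      have "exp (real (2 * n U * U) * ln (real X)) = real X ^ (2 * n U * U)"
        using X by (simp only: exp_of_nat_mult) simp
      then show ?thesis by (simp add: mult_ac)
    qed
    also have "\<dots> \<le> exp (real U ^ 2)"
      using mult_left_mono[OF small, of "real U"] by (simp add: power2_eq_square)
    finally have "real (card ?S) \<le> exp (real U ^ 2)" .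
    moreover have "finite ?S" using finP by auto
    moreover have "\<exists>l\<in>?S. \<exists>\<psi>. \<forall>d\<in>{..<U} \<times> {..<U}. \<psi> (l d) = code_output U f1 f2 d"
      if "f1 \<in> {..<U} \<rightarrow> words (n U) {..<X}" "f2 \<in> {..<U} \<rightarrow> words (n U) {..<X}" for f1 f2
    proof (intro bexI exI[of _ "\<lambda>z. z"] ballI)
      show "code_output U (restrict f1 {..<U}) (restrict f2 {..<U}) \<in> ?S"
        using that by (intro image_eqI[of _ _ "(restrict f1 {..<U}, restrict f2 {..<U})"]) auto
    qed (auto simp: code_output_def)
    ultimately obtain l where "l \<in> ?S" "real (card (l ` ({..<U} \<times> {..<U}))) > (1 - \<epsilon>) * real U ^ 2"
      using elim by metis
    then show "\<exists>f1 f2. f1 \<in> {..<U} \<rightarrow> words (n U) {..<X} \<and> f2 \<in> {..<U} \<rightarrow> words (n U) {..<X} \<and>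
      real (card (code_output U f1 f2 ` ({..<U} \<times> {..<U}))) > (1 - \<epsilon>) * real U ^ 2"
      by (auto simp: PiE_def)
  qed
qed

section \<open>Dependence of the channel on both inputs\<close>

lemma half_square:
  assumes "U \<ge> 2"
  shows "real U \<le> (1 - 1 / 2) * real U ^ 2"
  using mult_right_mono[of 2 "real U" "real U"] assms by (simp add: power2_eq_square)

text \<open>Otherwise the output is a function of the first message, so the single label
  \<open>fst\<close> serves all codes of any length. It takes only \<open>U \<le> U^2 / 2\<close>
  values, against \<open>labels_not_few\<close> with \<open>\<epsilon> = 1/2\<close>.\<close>

lemma depends_on_second: "\<exists>x1<X. \<exists>x2<X. \<exists>x2'<X. g (x1, x2) \<noteq> g (x1, x2')"
proof (rule ccontr)
  assume const: "\<not> ?thesis"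
  obtain U where U: "U \<ge> 2" and few: "\<forall>S :: (nat \<times> nat \<Rightarrow> nat) set.
    finite S \<longrightarrow> real (card S) \<le> exp (real U ^ 2) \<longrightarrow>
    (\<forall>f1 f2. f1 \<in> {..<U} \<rightarrow> words (n U) {..<X} \<longrightarrow> f2 \<in> {..<U} \<rightarrow> words (n U) {..<X} \<longrightarrow>
      (\<exists>l\<in>S. \<exists>\<psi>. \<forall>d\<in>{..<U} \<times> {..<U}. \<psi> (l d) = code_output U f1 f2 d)) \<longrightarrow>
    (\<exists>l\<in>S. real (card (l ` ({..<U} \<times> {..<U}))) > (1 - 1 / 2) * real U ^ 2)"
    using eventually_happens'[OF _ eventually_conj[OF eventually_ge_at_top[of 2] labels_not_few[of "1 / 2"]]]
    by auto
  have "\<exists>l\<in>{fst}. \<exists>\<psi>. \<forall>d\<in>{..<U} \<times> {..<U}. \<psi> (l d) = code_output U f1 f2 d"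
    if f: "f1 \<in> {..<U} \<rightarrow> words (n U) {..<X}" "f2 \<in> {..<U} \<rightarrow> words (n U) {..<X}" for f1 f2
  \<comment> \<open>Message 0 serves as an arbitrary second message.\<close>
  proof (intro bexI[of _ fst] exI[of _ "\<lambda>u. code_output U f1 f2 (u, 0)"] ballI)
    fix d assume "d \<in> {..<U} \<times> {..<U}"
    then show "code_output U f1 f2 (fst d, 0) = code_output U f1 f2 d"
      using const U word_less[OF f(1)] word_less[OF f(2)]
      by (auto simp: code_output_def channel_power_def intro!: restrict_ext)
  qed simp
  moreover have "fst ` ({..<U} \<times> {..<U}) = {..<U}" using U by force
  ultimately have "real U > (1 - 1 / 2) * real U ^ 2"
    using few[rule_format, of "{fst}"] by simp
  with half_square[OF U] show False by linarith
qed

text \<open>The same argument with the label \<open>snd\<close>.\<close>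

lemma depends_on_first: "\<exists>x2<X. \<exists>x1<X. \<exists>x1'<X. g (x1, x2) \<noteq> g (x1', x2)"
proof (rule ccontr)
  assume const: "\<not> ?thesis"
  obtain U where U: "U \<ge> 2" and few: "\<forall>S :: (nat \<times> nat \<Rightarrow> nat) set.
    finite S \<longrightarrow> real (card S) \<le> exp (real U ^ 2) \<longrightarrow>
    (\<forall>f1 f2. f1 \<in> {..<U} \<rightarrow> words (n U) {..<X} \<longrightarrow> f2 \<in> {..<U} \<rightarrow> words (n U) {..<X} \<longrightarrow>
      (\<exists>l\<in>S. \<exists>\<psi>. \<forall>d\<in>{..<U} \<times> {..<U}. \<psi> (l d) = code_output U f1 f2 d)) \<longrightarrow>
    (\<exists>l\<in>S. real (card (l ` ({..<U} \<times> {..<U}))) > (1 - 1 / 2) * real U ^ 2)"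
    using eventually_happens'[OF _ eventually_conj[OF eventually_ge_at_top[of 2] labels_not_few[of "1 / 2"]]]
    by auto
  have "\<exists>l\<in>{snd}. \<exists>\<psi>. \<forall>d\<in>{..<U} \<times> {..<U}. \<psi> (l d) = code_output U f1 f2 d"
    if f: "f1 \<in> {..<U} \<rightarrow> words (n U) {..<X}" "f2 \<in> {..<U} \<rightarrow> words (n U) {..<X}" for f1 f2
  proof (intro bexI[of _ snd] exI[of _ "\<lambda>u. code_output U f1 f2 (0, u)"] ballI)
    fix d assume "d \<in> {..<U} \<times> {..<U}"
    then show "code_output U f1 f2 (0, snd d) = code_output U f1 f2 d"
      using const U word_less[OF f(1)] word_less[OF f(2)]
      by (auto simp: code_output_def channel_power_def intro!: restrict_ext)
  qed simp
  moreover have "snd ` ({..<U} \<times> {..<U}) = {..<U}" using U by force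
  ultimately have "real U > (1 - 1 / 2) * real U ^ 2"
    using few[rule_format, of "{snd}"] by simp
  with half_square[OF U] show False by linarith
qed

section \<open>The achievable region and its optimum\<close>

text \<open>Convex combinations are what the time-sharing variable \<open>q\<close>
  provides.\<close>

definition region :: "(real \<times> real \<times> real) set" where
  "region = convex hull (entropy_triple X g ` (prob_vectors X \<times> prob_vectors X))"

text \<open>The largest \<open>l\<close> for which \<open>t\<close> dominates
  \<open>(2 l, l, l)\<close>, in proportion to the exponents 2, 1, 1 of the three
  inequalities.\<close>

definition level :: "real \<times> real \<times> real \<Rightarrow> real" where
  "level t = min (fst t / 2) (min (fst (snd t)) (snd (snd t)))"

lemma g_swap: "g \<circ> prod.swap \<in> {..<X} \<times> {..<X} \<rightarrow> {..<Y}"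
  using g by auto

text \<open>Uniform inputs have full support: dependence on the second input makes
  \<open>H(y)\<close> and \<open>H(y|x1)\<close> positive, dependence on the first makes
  \<open>H(y|x2)\<close> positive.\<close>

lemma positive_level: "\<exists>t\<in>region. level t > 0"
proof -
  define a where "a = (\<lambda>x. if x < X then 1 / real X else 0)"
  have a: "a \<in> prob_vectors X" using X by (auto simp: a_def prob_vectors_def)
  have pos: "a x > 0" if "x < X" for x using that by (simp add: a_def)
  obtain x1 x2 x2' where x: "x1 < X" "x2 < X" "x2' < X" "g (x1, x2) \<noteq> g (x1, x2')"
    using depends_on_second by blast
  obtain z1 z2 z2' where z: "z1 < X" "z2 < X" "z2' < X" "(g \<circ> prod.swap) (z1, z2) \<noteq> (g \<circ> prod.swap) (z1, z2')"
    using depends_on_first by auto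
  have "level (entropy_triple X g (a, a)) > 0"
    using out_row_entropy_pos[OF g a a pos pos x] out_row_entropy_pos(2)[OF g_swap a a pos pos z]
    by (simp only: level_def entropy_triple_def prod.case fst_conv snd_conv min_less_iff_conj) simp
  moreover have "entropy_triple X g (a, a) \<in> region"
    unfolding region_def by (rule hull_inc) (use a in auto)
  ultimately show ?thesis by blast
qed

lemma obtain_optimum:
  obtains t where "t \<in> region" "level t > 0" "\<And>s. s \<in> region \<Longrightarrow> level s \<le> level t"
proof -
  have "compact region"
    unfolding region_def by (rule compact_convex_hull[OF compact_entropy_triples[OF g]])
  moreover have "region \<noteq> {}" using positive_level by auto
  moreover have "continuous_on region level"
    unfolding level_def by (intro continuous_intros) auto
  ultimately obtain t where "t \<in> region" "\<And>s. s \<in> region \<Longrightarrow> level s \<le> level t"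
    using continuous_attains_sup by metis
  with positive_level that show ?thesis by (meson less_le_trans)
qed

text \<open>The point is the time average of the entropy triples of the letter laws.
  \<open>code_out_entropy_ge\<close> bounds its components from below, one representative being kept
  for each of the more than \<open>(1 - \<epsilon>) U^2\<close> outputs.\<close>

lemma good_code_level:
  assumes U: "U \<ge> 2" and \<epsilon>: "0 < \<epsilon>" "\<epsilon> \<le> 1 / 2" and log: "log 2 (real U) + log 2 (1 - \<epsilon>) \<ge> 0"
    and f: "f1 \<in> {..<U} \<rightarrow> words (n U) {..<X}" "f2 \<in> {..<U} \<rightarrow> words (n U) {..<X}"
    and card: "real (card (code_output U f1 f2 ` ({..<U} \<times> {..<U}))) > (1 - \<epsilon>) * real U ^ 2"
  shows "\<exists>t\<in>region. (1 - \<epsilon>) * (log 2 (real U) + log 2 (1 - \<epsilon>)) \<le> real (n U) * level t"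
proof -
  let ?D = "{..<U} \<times> {..<U}"
  let ?N = "real (n U)"
  define a where "a i = empirical U (\<lambda>u. f1 u i)" for i
  define b where "b i = empirical U (\<lambda>u. f2 u i)" for i
  define T where "T i = entropy_triple X g (a i, b i)" for i
  define t where "t = (\<Sum>i<n U. (1 / ?N) *\<^sub>R T i)"
  have npos: "?N > 0" using n_pos U by auto
  have Upos: "U > 0" "real U > 0" using U by auto
  have ab: "a i \<in> prob_vectors X" "b i \<in> prob_vectors X" if "i < n U" for i
    unfolding a_def b_def using that Upos word_less[OF f(1)] word_less[OF f(2)]
    by (auto intro!: empirical_in_prob_vectors)
  have "t \<in> region" unfolding t_def
    by (rule convex_sum) (use npos ab in \<open>auto simp: region_def T_def intro!: hull_inc\<close>)
  obtain R where R: "R \<subseteq> ?D" "inj_on (code_output U f1 f2) R" "code_output U f1 f2 ` ?D = code_output U f1 f2 ` R"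
    using subset_image_inj[of "code_output U f1 f2 ` ?D" "code_output U f1 f2" ?D] by auto
  define r where "r = real (card R)"
  have r: "r > (1 - \<epsilon>) * real U ^ 2" using card R by (simp add: r_def card_image)
  \<comment> \<open>The product \<open>x log (x / B)\<close> increases in \<open>x\<close> where the
    logarithm is nonnegative, so the number of outputs may be replaced by its lower bound.\<close>
  have mono: "(1 - \<epsilon>) * real U ^ 2 * log 2 ((1 - \<epsilon>) * real U ^ 2 / B) \<le> r * log 2 (r / B)"
    if "B > 0" "log 2 ((1 - \<epsilon>) * real U ^ 2 / B) \<ge> 0" for B
  proof (rule mult_mono)
    show "log 2 ((1 - \<epsilon>) * real U ^ 2 / B) \<le> log 2 (r / B)"
      using r that \<epsilon> Upos by (intro log_mono divide_right_mono divide_pos_pos mult_pos_pos) auto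
  qed (use r that in \<open>auto simp: r_def\<close>)
  have l2: "log 2 ((1 - \<epsilon>) * real U ^ 2) = 2 * log 2 (real U) + log 2 (1 - \<epsilon>)"
    using \<epsilon> Upos by (simp add: log_mult log_nat_power)
  have l1: "log 2 ((1 - \<epsilon>) * real U ^ 2 / real U) = log 2 (real U) + log 2 (1 - \<epsilon>)"
    using \<epsilon> Upos by (simp add: power2_eq_square log_mult)
  have lU: "log 2 (real U) \<ge> 0" "log 2 (1 - \<epsilon>) \<le> 0" using U \<epsilon> by auto
  have cancel: "(1 - \<epsilon>) * v \<le> s" if "(1 - \<epsilon>) * real U ^ 2 * v \<le> real U ^ 2 * s" for v s
  proof -
    have "real U ^ 2 * ((1 - \<epsilon>) * v) \<le> real U ^ 2 * s" using that by (simp add: mult_ac)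
    then show ?thesis using Upos by simp
  qed
  have inj: "inj_on (\<lambda>d. channel_power (n U) g (f1 (fst d), f2 (snd d))) R"
    using R(2) by (simp add: code_output_def[abs_def])
  note bounds = code_out_entropy_ge[OF g Upos(1) f R(1) inj, folded r_def a_def b_def]
  have "(1 - \<epsilon>) * (2 * log 2 (real U) + log 2 (1 - \<epsilon>)) \<le> (\<Sum>i<n U. out_entropy X g (a i) (b i))"
    using order_trans[OF mono[of 1] ] bounds(1) log lU by (intro cancel) (simp add: l2)
  moreover have "(\<Sum>i<n U. out_entropy X g (a i) (b i)) = ?N * fst t"
    using npos by (simp add: t_def T_def entropy_triple_def fst_sum sum_divide_distrib[symmetric])
  \<comment> \<open>Since \<open>log 2 (1 - \<epsilon>) \<le> 0\<close>, counting it twice only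
    weakens the bound; half of it then agrees with the other two.\<close>
  moreover have "(1 - \<epsilon>) * (2 * (log 2 (real U) + log 2 (1 - \<epsilon>))) \<le> (1 - \<epsilon>) * (2 * log 2 (real U) + log 2 (1 - \<epsilon>))"
    using lU \<epsilon> by (intro mult_left_mono) auto
  ultimately have "(1 - \<epsilon>) * (2 * (log 2 (real U) + log 2 (1 - \<epsilon>))) \<le> ?N * fst t"
    by linarith
  then have c1: "(1 - \<epsilon>) * (log 2 (real U) + log 2 (1 - \<epsilon>)) \<le> ?N * (fst t / 2)"
    by (simp only: mult.left_commute[of _ 2] times_divide_eq_right)
  have "(1 - \<epsilon>) * (log 2 (real U) + log 2 (1 - \<epsilon>)) \<le> (\<Sum>i<n U. row_entropy X g (a i) (b i))"
    using order_trans[OF mono[of "real U"] bounds(2)] log Upos by (intro cancel) (simp only: l1)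
  moreover have "(\<Sum>i<n U. row_entropy X g (a i) (b i)) = ?N * fst (snd t)"
    using npos by (simp add: t_def T_def entropy_triple_def fst_sum snd_sum sum_divide_distrib[symmetric])
  ultimately have c2: "(1 - \<epsilon>) * (log 2 (real U) + log 2 (1 - \<epsilon>)) \<le> ?N * fst (snd t)" by simp
  \<comment> \<open>For \<open>H(y|x2)\<close> the users change roles: encoders, channel and
    representatives are all swapped.\<close>
  have "inj_on (\<lambda>d. channel_power (n U) (g \<circ> prod.swap) (f2 (fst d), f1 (snd d))) (prod.swap ` R)"
    using R(2) by (auto simp: code_output_def channel_power_def inj_on_def)
  then have "real (card (prod.swap ` R)) * log 2 (real (card (prod.swap ` R)) / real U)
      \<le> real U ^ 2 * (\<Sum>i<n U. row_entropy X (g \<circ> prod.swap) (b i) (a i))"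
    unfolding a_def b_def by (intro code_out_entropy_ge[OF g_swap Upos(1) f(2,1)]) (use R(1) in auto)
  moreover have "card (prod.swap ` R) = card R" by (simp add: card_image)
  ultimately have "r * log 2 (r / real U) \<le> real U ^ 2 * (\<Sum>i<n U. row_entropy X (g \<circ> prod.swap) (b i) (a i))"
    by (simp add: r_def)
  then have "(1 - \<epsilon>) * (log 2 (real U) + log 2 (1 - \<epsilon>)) \<le> (\<Sum>i<n U. row_entropy X (g \<circ> prod.swap) (b i) (a i))"
    using order_trans[OF mono[of "real U"]] log Upos by (intro cancel) (simp only: l1)
  moreover have "(\<Sum>i<n U. row_entropy X (g \<circ> prod.swap) (b i) (a i)) = ?N * snd (snd t)"
    using npos by (simp add: t_def T_def entropy_triple_def fst_sum snd_sum sum_divide_distrib[symmetric])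
  ultimately have c3: "(1 - \<epsilon>) * (log 2 (real U) + log 2 (1 - \<epsilon>)) \<le> ?N * snd (snd t)" by simp
  have "(1 - \<epsilon>) * (log 2 (real U) + log 2 (1 - \<epsilon>)) \<le> ?N * level t"
    using c1 c2 c3 unfolding level_def min_def by simp
  with \<open>t \<in> region\<close> show ?thesis by blast
qed

text \<open>Two regimes. If \<open>2 n ln X \<le> U\<close>, a good code exists and its point has
  level at most \<open>l\<close>. Otherwise \<open>n\<close> grows at least linearly in
  \<open>U\<close> and any positive \<open>l\<close> outweighs \<open>log 2 U\<close>.\<close>

lemma level_ge:
  assumes l: "l > 0" "\<And>s. s \<in> region \<Longrightarrow> level s \<le> l" and \<eta>: "\<eta> < 1"
  shows "\<forall>\<^sub>F U in sequentially. \<eta> * log 2 (real U) \<le> real (n U) * l"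
proof -
  \<comment> \<open>This choice ensures \<open>\<eta> < 1 - \<epsilon>\<close> together with
    \<open>\<epsilon> \<le> 1/2\<close>, also for negative \<open>\<eta>\<close>.\<close>
  define \<epsilon> where "\<epsilon> = (1 - max \<eta> 0) / 2"
  have \<epsilon>: "\<epsilon> > 0" "\<epsilon> \<le> 1 / 2" "1 - \<epsilon> - \<eta> > 0" using \<eta> by (auto simp: \<epsilon>_def max_def field_simps)
  have lX: "ln (real X) > 0" using X by simp
  have log_top: "filterlim (\<lambda>U. log 2 (real U)) at_top sequentially" by real_asymp
  \<comment> \<open>The first threshold makes \<open>(1 - \<epsilon>) U\<close> at least one; the
    second absorbs the constant \<open>(1 - \<epsilon>) * log 2 (1 - \<epsilon>)\<close> into the
    gap between \<open>\<eta>\<close> and \<open>1 - \<epsilon>\<close>.\<close>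
  then have "\<forall>\<^sub>F U in sequentially. log 2 (real U) \<ge> max (- log 2 (1 - \<epsilon>)) (- ((1 - \<epsilon>) * log 2 (1 - \<epsilon>)) / (1 - \<epsilon> - \<eta>))"
    unfolding filterlim_at_top by blast
  moreover have "\<forall>\<^sub>F U in sequentially. \<eta> * log 2 (real U) \<le> real U / (2 * ln (real X)) * l"
  proof -
    have "((\<lambda>U. log 2 (real U) / real U) \<longlongrightarrow> 0) sequentially" by real_asymp
    then have "((\<lambda>U. \<eta> * (log 2 (real U) / real U)) \<longlongrightarrow> \<eta> * 0) sequentially" by (intro tendsto_intros)
    then have "\<forall>\<^sub>F U in sequentially. \<eta> * (log 2 (real U) / real U) < l / (2 * ln (real X))"
      using l lX by (intro order_tendstoD(2)) auto
    then show ?thesis using eventually_gt_at_top[of 0]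
    proof eventually_elim
      case (elim U)
      then show ?case using lX by (simp add: field_simps)
    qed
  qed
  ultimately show ?thesis using good_code[OF \<epsilon>(1)] eventually_ge_at_top[of 2]
  proof eventually_elim
    case (elim U)
    show ?case
    proof (cases "2 * real (n U) * ln (real X) \<le> real U")
      case True
      then obtain f1 f2 where "f1 \<in> {..<U} \<rightarrow> words (n U) {..<X}" "f2 \<in> {..<U} \<rightarrow> words (n U) {..<X}"
        "real (card (code_output U f1 f2 ` ({..<U} \<times> {..<U}))) > (1 - \<epsilon>) * real U ^ 2"
        using elim by blast
      then obtain t where t: "t \<in> region" "(1 - \<epsilon>) * (log 2 (real U) + log 2 (1 - \<epsilon>)) \<le> real (n U) * level t"
        using good_code_level[OF elim(4) \<epsilon>(1,2), of f1 f2] elim(1) by auto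
      have "\<eta> * log 2 (real U) \<le> (1 - \<epsilon>) * (log 2 (real U) + log 2 (1 - \<epsilon>))"
      proof -
        have "- ((1 - \<epsilon>) * log 2 (1 - \<epsilon>)) / (1 - \<epsilon> - \<eta>) \<le> log 2 (real U)" using elim(1) by simp
        then have "- ((1 - \<epsilon>) * log 2 (1 - \<epsilon>)) \<le> log 2 (real U) * (1 - \<epsilon> - \<eta>)"
          using \<epsilon>(3) by (simp only: pos_divide_le_eq)
        then show ?thesis by (simp add: algebra_simps)
      qed
      also note t(2)
      also have "real (n U) * level t \<le> real (n U) * l" using l(2)[OF t(1)] by (simp add: mult_left_mono)
      finally show ?thesis .
    next
      case False
      then have "real U / (2 * ln (real X)) \<le> real (n U)" using lX by (simp add: field_simps)
      then have "real U / (2 * ln (real X)) * l \<le> real (n U) * l" using l by (intro mult_right_mono) auto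
      then show ?thesis using elim(2) by linarith
    qed
  qed
qed

section \<open>Realising a point of the region by distributions\<close>

text \<open>The indices of a finite convex combination become the values of \<open>q\<close>, its
  coefficients their probabilities.\<close>

lemma region_pmfs:
  assumes "t \<in> region"
  shows "\<exists>(pq :: nat pmf) (p1 :: nat \<Rightarrow> nat pmf) (p2 :: nat \<Rightarrow> nat pmf) Q.
    finite Q \<and> set_pmf pq \<subseteq> Q \<and> (\<forall>q. set_pmf (p1 q) \<subseteq> {..<X}) \<and> (\<forall>q. set_pmf (p2 q) \<subseteq> {..<X}) \<and>
    t = (\<Sum>q\<in>Q. pmf pq q *\<^sub>R entropy_triple X g (pmf (p1 q), pmf (p2 q)))"
proof -
  obtain k u x where u: "\<forall>i\<in>{1::nat..k}. 0 \<le> u i \<and> x i \<in> entropy_triple X g ` (prob_vectors X \<times> prob_vectors X)"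
    and u1: "sum u {1..k} = 1" and t: "(\<Sum>i = 1..k. u i *\<^sub>R x i) = t"
    using assms unfolding region_def convex_hull_indexed by blast
  have "\<exists>pq. pmf pq = (\<lambda>i. if i \<in> {1..k} then u i else 0)"
    by (rule exists_pmf[of "{1..k}"]) (use u u1 in auto)
  then obtain pq where pq: "pmf pq = (\<lambda>i. if i \<in> {1..k} then u i else 0)" ..
  have vec: "\<exists>p. pmf p = a \<and> set_pmf p \<subseteq> {..<X}" if "a \<in> prob_vectors X" for a
  proof -
    have "\<exists>p. pmf p = a"
      by (rule exists_pmf[of "{..<X}"]) (use that in \<open>auto simp: prob_vectors_def\<close>)
    then obtain p where p: "pmf p = a" ..
    have "i < X" if "i \<in> set_pmf p" for i
      using that \<open>a \<in> prob_vectors X\<close> unfolding set_pmf_iff p prob_vectors_def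
      by (metis (mono_tags, lifting) mem_Collect_eq not_less)
    then show ?thesis using p by blast
  qed
  have "\<exists>p1 p2. set_pmf p1 \<subseteq> {..<X} \<and> set_pmf p2 \<subseteq> {..<X} \<and>
      (i \<in> {1..k} \<longrightarrow> x i = entropy_triple X g (pmf p1, pmf p2))" for i
  proof (cases "i \<in> {1..k}")
    case True
    then obtain a b where ab: "a \<in> prob_vectors X" "b \<in> prob_vectors X" "x i = entropy_triple X g (a, b)"
      using u by blast
    then show ?thesis using vec[OF ab(1)] vec[OF ab(2)] by metis
  next
    case False
    \<comment> \<open>Indices outside the combination get the point mass at letter 0, so the input
      laws live on the alphabet for every \<open>q\<close>.\<close>
    moreover have "set_pmf (return_pmf 0) \<subseteq> {..<X}" using X by auto
    ultimately show ?thesis by metis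
  qed
  then obtain p1 p2 where p: "\<And>i. set_pmf (p1 i) \<subseteq> {..<X}" "\<And>i. set_pmf (p2 i) \<subseteq> {..<X}"
      "\<And>i. i \<in> {1..k} \<Longrightarrow> x i = entropy_triple X g (pmf (p1 i), pmf (p2 i))"
    by metis
  have "set_pmf pq \<subseteq> {1..k}" by (auto simp: set_pmf_eq pq split: if_splits)
  moreover have "t = (\<Sum>q\<in>{1..k}. pmf pq q *\<^sub>R entropy_triple X g (pmf (p1 q), pmf (p2 q)))"
    unfolding t[symmetric] by (rule sum.cong) (auto simp: pq p(3))
  ultimately show ?thesis using p(1,2) by blast
qed

end

theorem theorem4:
  fixes X Y :: nat and g :: "nat \<times> nat \<Rightarrow> nat"
    and W n :: "nat \<Rightarrow> nat" and \<delta> :: "nat \<Rightarrow> real" and L :: real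
  assumes "X \<ge> 2" and "Y \<ge> 2"
    and "g \<in> {..<X} \<times> {..<X} \<rightarrow> {..<Y}"
    and "\<And>U. U \<ge> 2 \<Longrightarrow> 2 \<le> W U \<and> W U \<le> U ^ 2"
    and "filterlim W at_top sequentially"
    and "\<And>U. U \<ge> 2 \<Longrightarrow> 0 < \<delta> U \<and> \<delta> U \<le> 1 / (2 * ln (real (W U)))"
    and "\<And>U. U \<ge> 2 \<Longrightarrow> n U > 0"
    and "(\<lambda>U. real (card {a \<in> target_functions U (W U).
                feasible U (W U) (words (n U) {..<X}) (words (n U) {..<Y}) (\<delta> U)
                  a (channel_power (n U) g)})
            / real (card (target_functions U (W U)))) \<longlonglongrightarrow> L"
    and "L > 0"
  shows "\<exists>(pq :: nat pmf) (p1 :: nat \<Rightarrow> nat pmf) (p2 :: nat \<Rightarrow> nat pmf).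
    finite (set_pmf pq) \<and>
    (\<forall>q \<in> set_pmf pq. set_pmf (p1 q) \<subseteq> {..<X} \<and> set_pmf (p2 q) \<subseteq> {..<X}) \<and>
    (let p = joint_pmf pq p1 p2 g;
         rq = (\<lambda>(q, x1, x2, y). q);
         rx1 = (\<lambda>(q, x1, x2, y). x1);
         rx2 = (\<lambda>(q, x1, x2, y). x2);
         ry = (\<lambda>(q, x1, x2, y). y)
     in dot_le 2 (\<lambda>U. 2 powr (real (n U) * cond_entropy p ry rq)) \<and>
        dot_le 1 (\<lambda>U. 2 powr (real (n U) * cond_entropy p ry (\<lambda>\<omega>. (rx1 \<omega>, rq \<omega>)))) \<and>
        dot_le 1 (\<lambda>U. 2 powr (real (n U) * cond_entropy p ry (\<lambda>\<omega>. (rx2 \<omega>, rq \<omega>)))))"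
proof -
  interpret feasible_sequence X Y g W n \<delta> L
  proof
    show "2 \<le> W U" "\<delta> U \<le> 1 / (2 * ln (real (W U)))" if "U \<ge> 2" for U
      using assms(4,6)[OF that] by blast+
  qed (fact assms(1) assms(3) assms(5) assms(7) assms(8) assms(9))+
  obtain t where t: "t \<in> region" "level t > 0" "\<And>s. s \<in> region \<Longrightarrow> level s \<le> level t"
    by (rule obtain_optimum) blast
  obtain pq :: "nat pmf" and p1 p2 :: "nat \<Rightarrow> nat pmf" and Q where Q: "finite Q" "set_pmf pq \<subseteq> Q"
    and p: "\<And>q. set_pmf (p1 q) \<subseteq> {..<X}" "\<And>q. set_pmf (p2 q) \<subseteq> {..<X}"
    and sum: "t = (\<Sum>q\<in>Q. pmf pq q *\<^sub>R entropy_triple X g (pmf (p1 q), pmf (p2 q)))"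
    using region_pmfs[OF t(1)] by blast
  note ents = joint_pmf_cond_entropies[OF g Q p]
  have comps: "fst t = (\<Sum>q\<in>Q. pmf pq q * out_entropy X g (pmf (p1 q)) (pmf (p2 q)))"
    "fst (snd t) = (\<Sum>q\<in>Q. pmf pq q * row_entropy X g (pmf (p1 q)) (pmf (p2 q)))"
    "snd (snd t) = (\<Sum>q\<in>Q. pmf pq q * row_entropy X (g \<circ> prod.swap) (pmf (p2 q)) (pmf (p1 q)))"
    unfolding sum by (simp_all add: fst_sum snd_sum entropy_triple_def)
  have lev: "2 * level t \<le> fst t" "1 * level t \<le> fst (snd t)" "1 * level t \<le> snd (snd t)"
    by (auto simp: level_def)
  \<comment> \<open>Used with \<open>s\<close> equal to 2, 1, 1 and \<open>c\<close> the matching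
    component of \<open>t\<close>, which is at least \<open>s * level t\<close>.\<close>
  have dot: "dot_le s (\<lambda>U. 2 powr (real (n U) * c))" if "s > 0" "s * level t \<le> c" for s c
    by (rule dot_leI[OF that]) (rule level_ge[OF t(2,3)])
  show ?thesis
    unfolding Let_def
  proof (rule exI[of _ pq], rule exI[of _ p1], rule exI[of _ p2], intro conjI ballI p)
    show "finite (set_pmf pq)" using Q finite_subset by blast
  qed (simp_all only: ents comps[symmetric] dot[OF _ lev(1)] dot[OF _ lev(2)] dot[OF _ lev(3)] zero_less_numeral zero_less_one)
qed

end
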